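(* Let $\Gamma$ be a non-complete graph. Then $A_{\Gamma}$ has a right-angled Artin group $A_{\Gamma'}$ as a characteristic quotient, where $\Gamma'$ is a graph which is either (1) disconnected; or (2) connected, regular and non-complete; or (3) non-regular, connected and such that the induced subgraph $\Gamma'(V' \setminus V'_{\max})$ is complete, where $V'$ is the vertex set of $\Gamma'$ and $V'_{\max}$ is the set of vertices of $\Gamma'$ of maximal degree in $\Gamma'$.
   Context: A graph is a finite simple non-empty graph $\Gamma(V,E)$ with vertex set $V$ and edge set $E$; it is complete if every two distinct vertices are joined by an edge, and regular if all vertices have the same degree. The right-angled Artin group (RAAG) associated to $\Gamma$ is $A_\Gamma=\langle V \mid [v,w],\ vw\in E\rangle$. For $W\subseteq V$, $\Gamma(W)$ denotes the subgraph of $\Gamma$ induced on $W$. A group $H$ is a characteristic quotient of a group $G$ if $H\cong G/N$ for some characteristic subgroup $N$ of $G$. *)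

theory Defs
  imports "HOL-Algebra.Coset" "Graph_Theory.Digraph_Component"
begin

section \<open>Groups given by presentations\<close>

text \<open>
  A letter \<open>(s, True)\<close> stands for the generator \<open>s\<close> and \<open>(s, False)\<close> for its formal inverse.
\<close>

type_synonym 'a word = "('a \<times> bool) list"

definition words :: "'a set \<Rightarrow> 'a word set" where
  "words S = lists (S \<times> UNIV)"

text \<open>
  Two words over \<open>S\<close> represent the same element of \<open>\<langle>S | R\<rangle>\<close> iff they are related by the least
  congruence of the monoid of words that cancels adjacent mutually inverse letters and
  identifies every relator with the empty word.
\<close>

inductive_set pres_rel :: "'a set \<Rightarrow> 'a word set \<Rightarrow> ('a word \<times> 'a word) set"
  for S :: "'a set" and R :: "'a word set" where
  refl: "w \<in> words S \<Longrightarrow> (w, w) \<in> pres_rel S R"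
| sym: "(v, w) \<in> pres_rel S R \<Longrightarrow> (w, v) \<in> pres_rel S R"
| trans: "(u, v) \<in> pres_rel S R \<Longrightarrow> (v, w) \<in> pres_rel S R \<Longrightarrow> (u, w) \<in> pres_rel S R"
| cancel: "u \<in> words S \<Longrightarrow> v \<in> words S \<Longrightarrow> s \<in> S \<Longrightarrow>
    (u @ [(s, b), (s, \<not> b)] @ v, u @ v) \<in> pres_rel S R"
| relator: "u \<in> words S \<Longrightarrow> v \<in> words S \<Longrightarrow> r \<in> R \<Longrightarrow> r \<in> words S \<Longrightarrow>
    (u @ r @ v, u @ v) \<in> pres_rel S R"

definition presented_group :: "'a set \<Rightarrow> 'a word set \<Rightarrow> 'a word set monoid" where
  "presented_group S R =
    \<lparr>carrier = words S // pres_rel S R,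
     monoid.mult = (\<lambda>A B. \<Union>a\<in>A. \<Union>b\<in>B. pres_rel S R `` {a @ b}),
     monoid.one = pres_rel S R `` {[]}\<rparr>"

lemma append_in_words [simp]: "u @ v \<in> words S \<longleftrightarrow> u \<in> words S \<and> v \<in> words S"
  by (auto simp: words_def)

lemma Nil_in_words [simp]: "[] \<in> words S"
  by (simp add: words_def)

lemma Cons_in_words [simp]: "x # w \<in> words S \<longleftrightarrow> fst x \<in> S \<and> w \<in> words S"
  by (cases x) (auto simp: words_def)

lemma pres_rel_in_words:
  "(u, v) \<in> pres_rel S R \<Longrightarrow> u \<in> words S \<and> v \<in> words S"
  by (induction rule: pres_rel.induct) auto

lemma equiv_pres_rel: "equiv (words S) (pres_rel S R)"
proof (rule equivI)
  show "pres_rel S R \<subseteq> words S \<times> words S"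
    using pres_rel_in_words by fast
  show "refl_on (words S) (pres_rel S R)"
    by (auto intro!: refl_onI pres_rel.refl)
  show "Relation.sym (pres_rel S R)"
    by (rule symI) (rule pres_rel.sym)
  show "Relation.trans (pres_rel S R)"
    by (rule transI) (rule pres_rel.trans)
qed

lemma pres_rel_context:
  "(u, v) \<in> pres_rel S R \<Longrightarrow> x \<in> words S \<Longrightarrow> y \<in> words S \<Longrightarrow>
    (x @ u @ y, x @ v @ y) \<in> pres_rel S R"
proof (induction rule: pres_rel.induct)
  case (refl w)
  then show ?case by (auto intro: pres_rel.refl)
next
  case (sym v w)
  then show ?case by (blast intro: pres_rel.sym)
next
  case (trans u v w)
  then show ?case by (blast intro: pres_rel.trans)
next
  case (cancel u v s b)
  then show ?case using pres_rel.cancel[of "x @ u" S "v @ y" s b] by simp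
next
  case (relator u v r)
  then show ?case using pres_rel.relator[of "x @ u" S "v @ y" r] by simp
qed

lemma pres_rel_append:
  assumes "(u, u') \<in> pres_rel S R" "(v, v') \<in> pres_rel S R"
  shows "(u @ v, u' @ v') \<in> pres_rel S R"
proof (rule pres_rel.trans)
  show "(u @ v, u' @ v) \<in> pres_rel S R"
    using pres_rel_context[OF assms(1), of "[]" v] pres_rel_in_words[OF assms(2)] by simp
  show "(u' @ v, u' @ v') \<in> pres_rel S R"
    using pres_rel_context[OF assms(2), of u' "[]"] pres_rel_in_words[OF assms(1)] by simp
qed

lemma mult_presented_group:
  assumes "u \<in> words S" "v \<in> words S"
  shows "pres_rel S R `` {u} \<otimes>\<^bsub>presented_group S R\<^esub> pres_rel S R `` {v} = pres_rel S R `` {u @ v}"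
proof -
  have "pres_rel S R `` {a @ b} = pres_rel S R `` {u @ v}"
    if "(u, a) \<in> pres_rel S R" "(v, b) \<in> pres_rel S R" for a b
    using equiv_class_eq[OF equiv_pres_rel pres_rel_append[OF that]] by simp
  then have "(\<Union>b\<in>pres_rel S R `` {v}. pres_rel S R `` {a @ b}) = pres_rel S R `` {u @ v}"
    if "(u, a) \<in> pres_rel S R" for a
    using that pres_rel.refl[OF assms(2), of R] by (intro UN_constant_eq) auto
  then show ?thesis
    unfolding presented_group_def monoid.simps
    using pres_rel.refl[OF assms(1), of R] by (intro UN_constant_eq) auto
qed

lemma inv_word_cancel:
  "w \<in> words S \<Longrightarrow> (rev (map (\<lambda>(s, b). (s, \<not> b)) w) @ w, []) \<in> pres_rel S R"
proof (induction w)
  case Nil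
  then show ?case by (auto intro: pres_rel.refl)
next
  case (Cons x w)
  obtain s b where x: "x = (s, b)" by fastforce
  let ?w' = "rev (map (\<lambda>(s, b). (s, \<not> b)) w)"
  have "?w' \<in> words S" using Cons.prems by (auto simp: words_def)
  then have "(?w' @ [(s, \<not> b), (s, \<not> \<not> b)] @ w, ?w' @ w) \<in> pres_rel S R"
    using Cons.prems x by (intro pres_rel.cancel) auto
  then have "(rev (map (\<lambda>(s, b). (s, \<not> b)) (x # w)) @ x # w, ?w' @ w) \<in> pres_rel S R"
    using x by simp
  moreover have "(?w' @ w, []) \<in> pres_rel S R" using Cons by simp
  ultimately show ?case by (rule pres_rel.trans)
qed

theorem group_presented_group: "group (presented_group S R)"
proof (rule groupI)
  let ?G = "presented_group S R"
  let ?cl = "\<lambda>w. pres_rel S R `` {w}"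
  have carrier: "carrier ?G = ?cl ` words S"
    by (auto simp: presented_group_def quotient_def)
  have one: "\<one>\<^bsub>?G\<^esub> = ?cl []"
    by (simp add: presented_group_def)
  show "\<one>\<^bsub>?G\<^esub> \<in> carrier ?G"
    by (auto simp: carrier one)
  fix x assume "x \<in> carrier ?G"
  then obtain u where u: "u \<in> words S" "x = ?cl u" by (auto simp: carrier)
  show "\<one>\<^bsub>?G\<^esub> \<otimes>\<^bsub>?G\<^esub> x = x"
    using u by (simp add: one mult_presented_group)
  let ?u' = "rev (map (\<lambda>(s, b). (s, \<not> b)) u)"
  have "?u' \<in> words S" using u by (auto simp: words_def)
  moreover have "?cl (?u' @ u) = ?cl []"
    by (rule equiv_class_eq[OF equiv_pres_rel inv_word_cancel[OF u(1)]])
  ultimately show "\<exists>y\<in>carrier ?G. y \<otimes>\<^bsub>?G\<^esub> x = \<one>\<^bsub>?G\<^esub>"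
    using u by (auto simp: carrier one mult_presented_group intro!: bexI[of _ ?u'])
  fix y assume "y \<in> carrier ?G"
  then obtain v where v: "v \<in> words S" "y = ?cl v" by (auto simp: carrier)
  show "x \<otimes>\<^bsub>?G\<^esub> y \<in> carrier ?G"
    using u v by (auto simp: carrier mult_presented_group)
  fix z assume "z \<in> carrier ?G"
  then obtain w where w: "w \<in> words S" "z = ?cl w" by (auto simp: carrier)
  show "x \<otimes>\<^bsub>?G\<^esub> y \<otimes>\<^bsub>?G\<^esub> z = x \<otimes>\<^bsub>?G\<^esub> (y \<otimes>\<^bsub>?G\<^esub> z)"
    using u v w by (simp add: mult_presented_group)
qed

section \<open>Right-angled Artin groups\<close>

definition commutator_word :: "'a \<Rightarrow> 'a \<Rightarrow> 'a word" where
  "commutator_word v w = [(v, True), (w, True), (v, False), (w, False)]"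

definition raag :: "('a, 'b) pre_digraph \<Rightarrow> 'a word set monoid" where
  "raag G = presented_group (verts G) {commutator_word v w | v w. (v, w) \<in> arcs_ends G}"

section \<open>Characteristic quotients\<close>

definition characteristic_subgroup :: "'a set \<Rightarrow> ('a, 'b) monoid_scheme \<Rightarrow> bool" where
  "characteristic_subgroup N G \<longleftrightarrow> subgroup N G \<and> (\<forall>\<phi>\<in>iso G G. \<phi> ` N = N)"

definition characteristic_quotient ::
    "('c, 'd) monoid_scheme \<Rightarrow> ('a, 'b) monoid_scheme \<Rightarrow> bool" where
  "characteristic_quotient H G \<longleftrightarrow> (\<exists>N. characteristic_subgroup N G \<and> H \<cong> G Mod N)"

section \<open>Graphs\<close>

text \<open>
  An undirected edge is represented by the two opposite arcs between its ends, so the degree of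
  a vertex of a simple graph is its \<^const>\<open>out_degree\<close>.
\<close>

definition finite_simple_graph :: "'a pair_pre_digraph \<Rightarrow> bool" where
  "finite_simple_graph G \<longleftrightarrow> pair_graph G \<and> pverts G \<noteq> {}"

definition complete_graph :: "('a, 'b) pre_digraph \<Rightarrow> bool" where
  "complete_graph G \<longleftrightarrow>
    (\<forall>u\<in>verts G. \<forall>v\<in>verts G. u \<noteq> v \<longrightarrow> (u, v) \<in> arcs_ends G)"

definition regular_graph :: "('a, 'b) pre_digraph \<Rightarrow> bool" where
  "regular_graph G \<longleftrightarrow> (\<forall>u\<in>verts G. \<forall>v\<in>verts G. out_degree G u = out_degree G v)"

definition max_degree_verts :: "('a, 'b) pre_digraph \<Rightarrow> 'a set" where
  "max_degree_verts G = {v \<in> verts G. \<forall>u\<in>verts G. out_degree G u \<le> out_degree G v}"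

text \<open>\<open>connected\<close> alone could also denote topological connectedness.\<close>

abbreviation connected_graph :: "('a, 'b) pre_digraph \<Rightarrow> bool" where
  "connected_graph \<equiv> Digraph_Component.connected"

end

theory Submission
  imports Defs "HOL-Library.Poly_Mapping" "HOL-Computational_Algebra.Formal_Power_Series"
begin

text \<open>
  The vertices of maximal degree of a graph can be killed: if \<open>C\<close> is their set, then the kernel of
  the retraction of the group of the graph on \<open>V\<close> onto the group of the subgraph induced on
  \<open>V - C\<close> is characteristic (\<open>kill_max_degree_characteristic_epi\<close>). As long as a non-complete graph is
  not of one of the three kinds, \<open>V - C\<close> induces a non-complete graph again, so this can be repeated;
  it stops because \<open>C\<close> is never empty. Characteristic quotients compose because an automorphism that
  preserves a kernel descends to the quotient (\<open>characteristic_epi_comp\<close>).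

  To see that the kernel is characteristic, let \<open>\<phi>\<close> be an automorphism and \<open>v\<close> a vertex in \<open>C\<close>.
  The only thing known about \<open>\<phi> v\<close> is that it commutes with the images of the vertices in the star
  of \<open>v\<close>, which are as many as possible and independent in the abelianization. In the largest
  nilpotent quotient of class 2 this is linear algebra: if a vertex \<open>s\<close> occurs in the
  abelianized image of \<open>v\<close>, then an element that commutes with this image is determined by its
  coordinates at the star of \<open>s\<close>. Hence \<open>s\<close> has maximal degree too (\<open>support_in_max_star\<close>), and a multiple of every
  neighbour of \<open>s\<close> is a combination of the images of the star of \<open>v\<close> (\<open>neighbour_combination\<close>).

  So \<open>\<phi> v\<close> becomes trivial in the abelianization of the group on \<open>V - C\<close>, and it remains to exclude
  that it survives deeper in that group. The Magnus expansion \<open>s \<mapsto> 1 + s X\<close>, with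
  values in power series over the monoid ring of partially commuting words, is faithful
  (\<open>magnus_faithful\<close>). If some image of a vertex in \<open>C\<close> survived, its expansion would have a
  lowest term \<open>z\<close>. Comparing lowest terms in the commutation relations shows that every letter of
  \<open>z\<close> commutes with all neighbours of \<open>s\<close>. Such a letter is a vertex outside \<open>C\<close> whose star is at
  least as large as that of \<open>s\<close>, a contradiction (\<open>image_of_max_star_vanishes\<close>).
\<close>

unbundle fps_syntax

section \<open>Traces\<close>

text \<open>
  A word in partially commuting letters (a trace) is determined by its projections to pairs of
  letters that do not commute; the pair \<open>(p, p)\<close> counts the letter \<open>p\<close>. Encoding a trace by its
  family of projections makes the monoid cancellative by construction, and the type does not
  depend on the graph.
\<close>

typedef 'a trace = "UNIV :: ('a \<Rightarrow> 'a \<Rightarrow> 'a list) set"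
  morphisms projection Trace
  by simp

setup_lifting type_definition_trace

instantiation trace :: (type) "{monoid_add, cancel_semigroup_add}"
begin

lift_definition zero_trace :: "'a trace" is "\<lambda>p q. []" .

lift_definition plus_trace :: "'a trace \<Rightarrow> 'a trace \<Rightarrow> 'a trace" is "\<lambda>m m' p q. m p q @ m' p q" .

instance by standard (transfer; simp add: fun_eq_iff)+

end

lift_definition trace_letter :: "('a \<times> 'a) set \<Rightarrow> 'a \<Rightarrow> 'a trace"
  is "\<lambda>E a p q. if (p, q) \<notin> E \<and> (a = p \<or> a = q) then [a] else []" .

definition trace_of :: "('a \<times> 'a) set \<Rightarrow> 'a list \<Rightarrow> 'a trace" where
  "trace_of E w = sum_list (map (trace_letter E) w)"

lemma trace_of_simps [simp]:
  "trace_of E [] = 0"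
  "trace_of E (a # w) = trace_letter E a + trace_of E w"
  "trace_of E (w @ w') = trace_of E w + trace_of E w'"
  by (simp_all add: trace_of_def)

lemma projection_simps [simp]:
  "projection 0 p q = []"
  "projection (m + m') p q = projection m p q @ projection m' p q"
  by (transfer; simp)+

lemma projection_trace_of:
  "projection (trace_of E w) p q = (if (p, q) \<in> E then [] else filter (\<lambda>a. a = p \<or> a = q) w)"
proof (induction w)
  case (Cons a w)
  then show ?case by (simp add: trace_letter.rep_eq)
qed simp

lemma trace_letter_commute:
  assumes "(a, b) \<in> E" "Relation.sym E" "irrefl E"
  shows "trace_letter E a + trace_letter E b = trace_letter E b + trace_letter E a"
proof -
  have "a \<noteq> b" using assms(1,3) by (auto simp: irrefl_def)
  moreover have "(b, a) \<in> E" using assms(1,2) by (auto dest: symD)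
  ultimately show ?thesis using assms(1) by transfer (auto simp: fun_eq_iff)
qed

lemma set_trace_of_eq:
  assumes "trace_of E w = trace_of E w'" "irrefl E"
  shows "set w = set w'"
proof -
  have "filter (\<lambda>a. a = p \<or> a = p) w = filter (\<lambda>a. a = p \<or> a = p) w'" for p
    using projection_trace_of[of E w p p] projection_trace_of[of E w' p p] assms
    by (auto simp: irrefl_def)
  then have "p \<in> set (filter (\<lambda>a. a = p) w) \<longleftrightarrow> p \<in> set (filter (\<lambda>a. a = p) w')" for p
    by simp
  then show ?thesis by auto
qed

text \<open>
  The projections to \<open>a\<close> and a letter \<open>b\<close> that does not commute with it begin with \<open>a\<close>, so in \<open>w'\<close>
  no such \<open>b\<close> precedes the first \<open>a\<close>.
\<close>

lemma trace_of_Cons_eqE: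
  assumes "trace_of E (a # w) = trace_of E w'" "irrefl E" "Relation.sym E"
  obtains x y where "w' = x @ a # y" "\<forall>b\<in>set x. (a, b) \<in> E" "trace_of E w = trace_of E (x @ y)"
proof -
  have "a \<in> set w'" using set_trace_of_eq[OF assms(1,2)] by auto
  then obtain x y where w': "w' = x @ a # y" "a \<notin> set x"
    by (meson split_list_first)
  have adj: "(a, b) \<in> E" if "b \<in> set x" for b
  proof (rule ccontr)
    assume nadj: "(a, b) \<notin> E"
    define P where "P = (\<lambda>c. c = a \<or> c = b)"
    have "a # filter P w = filter P x @ a # filter P y"
      using arg_cong[OF assms(1), of "\<lambda>m. projection m a b"] nadj w'(1)
        projection_trace_of[of E "a # w" a b] projection_trace_of[of E w' a b]
      by (simp add: P_def)
    moreover have "b \<in> set (filter P x)" "a \<notin> set (filter P x)"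
      using that w'(2) by (simp_all add: P_def)
    ultimately show False by (cases "filter P x") auto
  qed
  have "trace_of E x + trace_letter E a = trace_letter E a + trace_of E x"
    using adj
  proof (induction x)
    case (Cons b x)
    have "trace_letter E b + trace_letter E a = trace_letter E a + trace_letter E b"
      using trace_letter_commute[of a b E] Cons.prems assms by auto
    then show ?case using Cons by (metis (no_types, lifting) add.assoc list.set_intros(2) trace_of_simps(2))
  qed simp
  then have "trace_letter E a + trace_of E w = trace_letter E a + trace_of E (x @ y)"
    using assms(1) w'(1) by (simp add: add.assoc [symmetric])
  then have "trace_of E w = trace_of E (x @ y)" by (metis add_left_cancel)
  then show thesis using that w' adj by blast
qed

section \<open>The integral monoid ring of traces\<close>

abbreviation lookup :: "('k \<Rightarrow>\<^sub>0 'v::zero) \<Rightarrow> 'k \<Rightarrow> 'v" where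
  "lookup \<equiv> Poly_Mapping.lookup"

abbreviation keys :: "('k \<Rightarrow>\<^sub>0 'v::zero) \<Rightarrow> 'k set" where
  "keys \<equiv> Poly_Mapping.keys"

lemma poly_mapping_eq_sum_single: "p = (\<Sum>k\<in>keys p. Poly_Mapping.single k (lookup p k))"
  by (rule poly_mapping_eqI) (simp add: lookup_sum lookup_single when_def sum.delta in_keys_iff)

lemma lookup_times_single_right:
  fixes p :: "'m::{monoid_add, cancel_semigroup_add} \<Rightarrow>\<^sub>0 int"
  shows "lookup (p * Poly_Mapping.single a c) (m + a) = lookup p m * c"
proof -
  have "p * Poly_Mapping.single a c = (\<Sum>k\<in>keys p. Poly_Mapping.single (k + a) (lookup p k * c))"
    by (subst (1) poly_mapping_eq_sum_single) (simp add: sum_distrib_right mult_single)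
  then show ?thesis
    by (simp add: lookup_sum lookup_single when_def sum.delta in_keys_iff)
qed

lemma keys_single_subset: "keys (Poly_Mapping.single k c) \<subseteq> {k}"
  by simp

lemma single_sum:
  "Poly_Mapping.single k (sum h I) = (\<Sum>i\<in>I. Poly_Mapping.single k (h i :: int))"
  by (induction I rule: infinite_finite_induct) (auto simp: single_add)

lemma keys_timesI:
  assumes "\<And>a b. a \<in> keys p \<Longrightarrow> b \<in> keys q \<Longrightarrow> a + b \<in> S"
  shows "keys (p * q) \<subseteq> S"
  using keys_mult[of p q] assms by blast

lemma keys_timesE:
  assumes "k \<in> keys (p * q)"
  obtains a b where "k = a + b" "a \<in> keys p" "b \<in> keys q"
  using keys_mult[of p q] assms by blast

section \<open>The Magnus expansion of a word\<close>

text \<open>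
  The Magnus expansion sends a generator \<open>s\<close> to \<open>1 + s X\<^sup>d\<close> over the monoid ring of traces, where
  \<open>d\<close> is the weight of \<open>s\<close>. The formal variable makes the inverse of this series available, and
  its exponent records the weight of a monomial.
\<close>

definition generator_series ::
    "('a \<times> 'a) set \<Rightarrow> ('a \<Rightarrow> nat) \<Rightarrow> 'a \<Rightarrow> ('a trace \<Rightarrow>\<^sub>0 int) fps" where
  "generator_series E d s =
    Abs_fps (\<lambda>j. if j = 0 then 1 else if j = d s then Poly_Mapping.single (trace_letter E s) 1 else 0)"

definition magnus ::
    "('a \<times> 'a) set \<Rightarrow> ('a \<Rightarrow> nat) \<Rightarrow> 'a word \<Rightarrow> ('a trace \<Rightarrow>\<^sub>0 int) fps" where
  "magnus E d w =
    prod_list (map (\<lambda>(s, b). if b then generator_series E d s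
      else fps_right_inverse (generator_series E d s) 1) w)"

abbreviation unit_weight :: "'a \<Rightarrow> nat" where
  "unit_weight \<equiv> \<lambda>_. 1"

lemma magnus_Nil [simp]: "magnus E d [] = 1"
  by (simp add: magnus_def)

lemma magnus_append [simp]: "magnus E d (u @ v) = magnus E d u * magnus E d v"
  by (simp add: magnus_def)

lemma magnus_Cons: "magnus E d (x # v) = magnus E d [x] * magnus E d v"
  by (simp add: magnus_def)

lemma magnus_inverse:
  "magnus E d [(s, True)] * magnus E d [(s, False)] = 1"
  "magnus E d [(s, False)] * magnus E d [(s, True)] = 1"
  using fps_right_inverse[of "generator_series E d s" 1]
    fps_left_inverse'[of 1 "generator_series E d s" 1]
  by (simp_all add: magnus_def generator_series_def)

lemma fps_times_commute:
  fixes f g :: "'r::ring_1 fps"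
  assumes "\<And>i j. f $ i * g $ j = g $ j * f $ i"
  shows "f * g = g * f"
proof (rule fps_ext)
  fix n
  have "(f * g) $ n = (\<Sum>i=0..n. g $ (n - i) * f $ i)"
    by (simp add: fps_mult_nth assms)
  also have "\<dots> = (\<Sum>i=0..n. g $ i * f $ (n - i))"
    by (rule sum.reindex_bij_witness[of _ "\<lambda>i. n - i" "\<lambda>i. n - i"]) auto
  finally show "(f * g) $ n = (g * f) $ n" by (simp add: fps_mult_nth)
qed

lemma magnus_generators_commute:
  assumes "(a, b) \<in> E" "Relation.sym E" "irrefl E"
  shows "magnus E d [(a, True)] * magnus E d [(b, True)] =
    magnus E d [(b, True)] * magnus E d [(a, True)]"
  unfolding magnus_def
  by (simp, rule fps_times_commute)
    (use trace_letter_commute[OF assms] in \<open>auto simp: generator_series_def mult_single\<close>)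

lemma magnus_commutator_word:
  assumes "(a, b) \<in> E" "Relation.sym E" "irrefl E"
  shows "magnus E d (commutator_word a b) = 1"
proof -
  let ?M = "\<lambda>s b. magnus E d [(s, b)]"
  have "magnus E d (commutator_word a b) = ?M a True * ?M b True * ?M a False * ?M b False"
    by (simp add: commutator_word_def magnus_def mult.assoc)
  also have "\<dots> = ?M b True * (?M a True * ?M a False) * ?M b False"
    by (simp add: magnus_generators_commute[OF assms] mult.assoc)
  also have "\<dots> = 1"
    by (simp add: magnus_inverse)
  finally show ?thesis .
qed

text \<open>
  A relator counts only if it is a word over the given vertex set, so restricting the vertices
  restricts the graph: one relation \<open>E\<close> serves for all induced subgraphs.
\<close>

abbreviation raag_rel :: "('a \<times> 'a) set \<Rightarrow> 'a set \<Rightarrow> ('a word \<times> 'a word) set" where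
  "raag_rel E V \<equiv> pres_rel V {commutator_word v w | v w. (v, w) \<in> E}"

lemma magnus_cong:
  assumes "(u, v) \<in> raag_rel E V" "Relation.sym E" "irrefl E"
  shows "magnus E d u = magnus E d v"
  using assms(1)
proof (induction rule: pres_rel.induct)
  case (cancel u v s b)
  have "magnus E d [(s, b), (s, \<not> b)] = 1"
    using magnus_inverse[of E d s] by (cases b) (simp_all add: magnus_def)
  then show ?case by (simp del: append_Cons add: mult.assoc [symmetric])
next
  case (relator u v r)
  then show ?case using magnus_commutator_word[OF _ assms(2,3), of _ _ d] by auto
qed auto

lemma magnus_nth_0 [simp]: "magnus E d w $ 0 = 1"
proof (induction w)
  case (Cons x w)
  obtain s b where "x = (s, b)" by fastforce
  then have "magnus E d [x] $ 0 = 1"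
    by (cases b) (simp_all add: magnus_def generator_series_def)
  then show ?case using Cons by (subst magnus_Cons) simp
qed simp

lemma magnus_False_nth:
  assumes "n > 0" "d s > 0"
  shows "magnus E d [(s, False)] $ n =
    (if n < d s then 0
     else - Poly_Mapping.single (trace_letter E s) 1 * magnus E d [(s, False)] $ (n - d s))"
proof -
  let ?g = "magnus E d [(s, False)]" and ?a = "Poly_Mapping.single (trace_letter E s) 1"
  have "0 = (generator_series E d s * ?g) $ n"
    using magnus_inverse(1)[of E d s] assms by (simp add: magnus_def)
  also have "\<dots> = (\<Sum>i\<in>{0..n}. (if i = 0 then ?g $ n else 0) + (if i = d s then ?a * ?g $ (n - d s) else 0))"
    unfolding fps_mult_nth by (rule sum.cong) (use assms in \<open>auto simp: generator_series_def\<close>)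
  also have "\<dots> = ?g $ n + (if d s \<le> n then ?a * ?g $ (n - d s) else 0)"
    by (simp add: sum.distrib)
  finally show ?thesis by (auto simp: eq_neg_iff_add_eq_0)
qed

section \<open>Right-angled Artin groups of induced subgraphs\<close>

abbreviation Raag :: "('a \<times> 'a) set \<Rightarrow> 'a set \<Rightarrow> 'a word set monoid" where
  "Raag E V \<equiv> presented_group V {commutator_word v w | v w. (v, w) \<in> E}"

abbreviation word_class :: "('a \<times> 'a) set \<Rightarrow> 'a set \<Rightarrow> 'a word \<Rightarrow> 'a word set" where
  "word_class E V w \<equiv> raag_rel E V `` {w}"

abbreviation generator :: "('a \<times> 'a) set \<Rightarrow> 'a set \<Rightarrow> 'a \<Rightarrow> 'a word set" where
  "generator E V v \<equiv> word_class E V [(v, True)]"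

lemma carrier_presented_group: "carrier (presented_group S R) = (\<lambda>w. pres_rel S R `` {w}) ` words S"
  by (auto simp: presented_group_def quotient_def)

lemma one_presented_group: "\<one>\<^bsub>presented_group S R\<^esub> = pres_rel S R `` {[]}"
  by (simp add: presented_group_def)

lemma word_class_in_carrier [simp]: "w \<in> words S \<Longrightarrow> pres_rel S R `` {w} \<in> carrier (presented_group S R)"
  by (simp add: carrier_presented_group)

lemma pres_class_eq_iff:
  assumes "u \<in> words S" "v \<in> words S"
  shows "pres_rel S R `` {u} = pres_rel S R `` {v} \<longleftrightarrow> (u, v) \<in> pres_rel S R"
  using eq_equiv_class_iff[OF equiv_pres_rel assms] by simp

lemma pres_rel_some:
  assumes "w \<in> words S"
  shows "(w, SOME u. u \<in> pres_rel S R `` {w}) \<in> pres_rel S R"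
proof -
  have "w \<in> pres_rel S R `` {w}" using assms by (auto intro: pres_rel.refl)
  then have "(SOME u. u \<in> pres_rel S R `` {w}) \<in> pres_rel S R `` {w}" by (rule someI)
  then show ?thesis by (simp only: Image_singleton_iff)
qed

lemma inv_generator:
  assumes "v \<in> V"
  shows "inv\<^bsub>Raag E V\<^esub> (generator E V v) = word_class E V [(v, False)]"
proof -
  interpret group "Raag E V" by (rule group_presented_group)
  have "([(v, False), (v, \<not> False)], []) \<in> raag_rel E V"
    using pres_rel.cancel[of "[]" V "[]" v False] assms by simp
  then have "word_class E V [(v, False)] \<otimes>\<^bsub>Raag E V\<^esub> generator E V v = \<one>\<^bsub>Raag E V\<^esub>"
    using assms by (simp add: mult_presented_group one_presented_group pres_class_eq_iff)
  then show ?thesis using assms by (intro inv_equality) auto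
qed

lemma generators_commute:
  assumes "(a, b) \<in> E" "a \<in> V" "b \<in> V"
  shows "generator E V a \<otimes>\<^bsub>Raag E V\<^esub> generator E V b = generator E V b \<otimes>\<^bsub>Raag E V\<^esub> generator E V a"
    (is "?a \<otimes>\<^bsub>?G\<^esub> ?b = _")
proof -
  interpret group ?G by (rule group_presented_group)
  have "(commutator_word a b, []) \<in> raag_rel E V"
    using pres_rel.relator[of "[]" V "[]" "commutator_word a b"] assms
    by (auto simp: commutator_word_def)
  then have "word_class E V ([(a, True)] @ [(b, True)] @ [(a, False)] @ [(b, False)]) = \<one>\<^bsub>?G\<^esub>"
    using assms by (simp add: one_presented_group pres_class_eq_iff commutator_word_def)
  moreover have "word_class E V ([(a, True)] @ [(b, True)] @ [(a, False)] @ [(b, False)]) =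
      ?a \<otimes>\<^bsub>?G\<^esub> (?b \<otimes>\<^bsub>?G\<^esub> (inv\<^bsub>?G\<^esub> ?a \<otimes>\<^bsub>?G\<^esub> inv\<^bsub>?G\<^esub> ?b))"
    using assms by (simp add: inv_generator mult_presented_group)
  moreover have c: "?a \<in> carrier ?G" "?b \<in> carrier ?G"
    using assms by simp_all
  ultimately have "(?a \<otimes>\<^bsub>?G\<^esub> ?b) \<otimes>\<^bsub>?G\<^esub> inv\<^bsub>?G\<^esub> (?b \<otimes>\<^bsub>?G\<^esub> ?a) =
      (?b \<otimes>\<^bsub>?G\<^esub> ?a) \<otimes>\<^bsub>?G\<^esub> inv\<^bsub>?G\<^esub> (?b \<otimes>\<^bsub>?G\<^esub> ?a)"
    using r_inv[OF m_closed[OF c(2,1)]] c by (simp only: inv_mult_group m_assoc m_closed inv_closed)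
  then show ?thesis
    using c by (subst (asm) right_cancel) (simp_all only: m_closed inv_closed)
qed

text \<open>Every word in the class \<open>A\<close> has the same Magnus expansion.\<close>

definition magnus_class ::
    "('a \<times> 'a) set \<Rightarrow> ('a \<Rightarrow> nat) \<Rightarrow> 'a word set \<Rightarrow> ('a trace \<Rightarrow>\<^sub>0 int) fps" where
  "magnus_class E d A = magnus E d (SOME w. w \<in> A)"

lemma magnus_class_word_class:
  assumes "w \<in> words V" "Relation.sym E" "irrefl E"
  shows "magnus_class E d (word_class E V w) = magnus E d w"
  unfolding magnus_class_def
  by (rule magnus_cong[OF pres_rel_some[OF assms(1)] assms(2,3), symmetric])

lemma magnus_class_mult:
  assumes "x \<in> carrier (Raag E V)" "y \<in> carrier (Raag E V)" "Relation.sym E" "irrefl E"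
  shows "magnus_class E d (x \<otimes>\<^bsub>Raag E V\<^esub> y) = magnus_class E d x * magnus_class E d y"
  using assms by (auto simp: carrier_presented_group mult_presented_group magnus_class_word_class)

section \<open>Faithfulness of the Magnus expansion\<close>

text \<open>A syllable \<open>(v, e)\<close> stands for the power of the generator \<open>g v\<close> with exponent \<open>e\<close>.\<close>

definition (in group) syllable_product :: "('v \<Rightarrow> 'a) \<Rightarrow> ('v \<times> int) list \<Rightarrow> 'a" where
  "syllable_product g S = foldr (\<lambda>(v, e) x. g v [^] e \<otimes> x) S \<one>"

context group
begin

lemma syllable_product_simps [simp]:
  "syllable_product g [] = \<one>"
  "syllable_product g ((v, e) # S) = g v [^] e \<otimes> syllable_product g S"
  by (simp_all add: syllable_product_def)

lemma syllable_product_closed: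
  "\<forall>v\<in>fst ` set S. g v \<in> carrier G \<Longrightarrow> syllable_product g S \<in> carrier G"
  by (induction S) auto

lemma syllable_product_append:
  "\<forall>v\<in>fst ` set S. g v \<in> carrier G \<Longrightarrow> \<forall>v\<in>fst ` set T. g v \<in> carrier G \<Longrightarrow>
    syllable_product g (S @ T) = syllable_product g S \<otimes> syllable_product g T"
  by (induction S) (auto simp: m_assoc syllable_product_closed)

lemma int_pow_commute:
  assumes "x \<in> carrier G" "y \<in> carrier G" "x \<otimes> y = y \<otimes> x"
  shows "x [^] (i::int) \<otimes> y = y \<otimes> x [^] i"
proof (induction i rule: int_induct[where k = 0])
  case base
  then show ?case using assms by simp
next
  case (step1 i)
  have "x [^] (i + 1) = x [^] i \<otimes> x" using assms int_pow_mult[of x i 1] by simp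
  then show ?case using assms step1(2) by (metis int_pow_closed m_assoc)
next
  case (step2 i)
  have "inv x \<otimes> y = y \<otimes> inv x"
    using assms by (metis inv_closed inv_solve_left inv_solve_right m_assoc m_closed)
  moreover have "x [^] (i - 1) = x [^] i \<otimes> inv x" using assms int_pow_diff[of x i 1] by simp
  ultimately show ?case using assms step2(2) by (metis int_pow_closed inv_closed m_assoc)
qed

text \<open>
  Only the underlying letters matter for moving syllables past each other, so a rearrangement of
  the letters of a syllable word lifts to the syllables.
\<close>

lemma syllable_product_rearrange:
  assumes "Relation.sym E" "irrefl E"
    and "\<And>v. v \<in> W \<Longrightarrow> g v \<in> carrier G"
    and "\<And>u v. u \<in> W \<Longrightarrow> v \<in> W \<Longrightarrow> (u, v) \<in> E \<Longrightarrow> g u \<otimes> g v = g v \<otimes> g u"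
  shows "trace_of E (map fst S) = trace_of E w \<Longrightarrow> fst ` set S \<subseteq> W \<Longrightarrow>
    \<exists>T. map fst T = w \<and> length T = length S \<and> syllable_product g T = syllable_product g S"
proof (induction S arbitrary: w)
  case Nil
  then show ?case using set_trace_of_eq[of E "[]" w] assms(2) by simp
next
  case (Cons s S)
  obtain a e where s: "s = (a, e)" by fastforce
  obtain x y where w: "w = x @ a # y" "\<forall>b\<in>set x. (a, b) \<in> E"
      "trace_of E (map fst S) = trace_of E (x @ y)"
    using trace_of_Cons_eqE[of E a "map fst S" w] Cons.prems(1) s assms(1,2) by auto
  obtain T where T: "map fst T = x @ y" "length T = length S" "syllable_product g T = syllable_product g S"
    using Cons.IH[OF w(3)] Cons.prems(2) by auto
  define X Y where "X = take (length x) T" and "Y = drop (length x) T"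
  have XY: "map fst X = x" "map fst Y = y" "T = X @ Y"
    using T(1) by (simp_all add: X_def Y_def take_map [symmetric] drop_map [symmetric])
  have W: "a \<in> W" "set x \<subseteq> W" "set y \<subseteq> W"
    using set_trace_of_eq[OF Cons.prems(1) assms(2)] Cons.prems(2) w(1) by auto
  have cl: "fst ` set X \<subseteq> W" "fst ` set Y \<subseteq> W"
    unfolding set_map [symmetric] XY using W by simp_all
  have clX: "\<forall>v\<in>fst ` set X. g v \<in> carrier G" and clY: "\<forall>v\<in>fst ` set Y. g v \<in> carrier G"
    using cl assms(3) by auto
  have adj: "\<forall>b\<in>fst ` set X. (a, b) \<in> E"
    unfolding set_map [symmetric] XY using w(2) by simp
  have "syllable_product g X \<otimes> g a [^] e = g a [^] e \<otimes> syllable_product g X"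
    using cl(1) adj
  proof (induction X)
    case (Cons r X)
    obtain b i where r: "r = (b, i)" by fastforce
    have b: "b \<in> W" "(a, b) \<in> E" and X: "\<forall>v\<in>fst ` set X. g v \<in> carrier G"
      using Cons.prems r assms(3) by auto
    have "g a [^] e \<otimes> g b = g b \<otimes> g a [^] e"
      using int_pow_commute[of "g a" "g b" e] assms(3,4) W(1) b by auto
    then have "g b [^] i \<otimes> g a [^] e = g a [^] e \<otimes> g b [^] i"
      using int_pow_commute[of "g b" "g a [^] e" i] assms(3) W(1) b by auto
    then show ?case
      using Cons r b X W assms(3) syllable_product_closed[OF X]
      by (simp add: m_assoc) (simp add: m_assoc [symmetric])
  qed (use assms(3) W in simp)
  moreover have "syllable_product g (X @ (a, e) # Y) =
      syllable_product g X \<otimes> (g a [^] e \<otimes> syllable_product g Y)"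
    using syllable_product_append[OF clX, of "(a, e) # Y"] clY W(1) assms(3) by simp
  moreover have "syllable_product g T = syllable_product g X \<otimes> syllable_product g Y"
    unfolding XY(3) by (rule syllable_product_append[OF clX clY])
  ultimately have "syllable_product g (X @ (a, e) # Y) = syllable_product g ((a, e) # T)"
    using syllable_product_closed[OF clX] syllable_product_closed[OF clY] assms(3)[OF W(1)]
    by (simp add: m_assoc [symmetric])
  then have "syllable_product g (X @ (a, e) # Y) = syllable_product g (s # S)"
    using T(3) s by simp
  moreover have "length (X @ (a, e) # Y) = length (s # S)" using XY(3) T(2) by simp
  moreover have "map fst (X @ (a, e) # Y) = w" using XY w(1) by simp
  ultimately show ?case by blast
qed

end

text \<open>
  \<open>f\<close> is an integer power series in the letter \<open>v\<close> that starts with \<open>1 + e v\<close>, as does the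
  expansion of the power of a generator with exponent \<open>e\<close>.
\<close>

definition power_like :: "('a \<times> 'a) set \<Rightarrow> 'a \<Rightarrow> int \<Rightarrow> ('a trace \<Rightarrow>\<^sub>0 int) fps \<Rightarrow> bool" where
  "power_like E v e f \<longleftrightarrow> (\<exists>c. c 0 = 1 \<and> c 1 = e \<and>
    (\<forall>j. f $ j = Poly_Mapping.single (trace_of E (replicate j v)) (c j)))"

lemma trace_of_replicate_add:
  "trace_of E (replicate i v) + trace_of E (replicate j v) = trace_of E (replicate (i + j) v)"
  by (simp add: replicate_add)

lemma power_like_times:
  assumes "power_like E v e f" "power_like E v e' f'"
  shows "power_like E v (e + e') (f * f')"
proof -
  obtain c where c: "c 0 = 1" "c 1 = e" "\<And>j. f $ j = Poly_Mapping.single (trace_of E (replicate j v)) (c j)"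
    using assms(1) by (auto simp: power_like_def)
  obtain c' where c': "c' 0 = 1" "c' 1 = e'" "\<And>j. f' $ j = Poly_Mapping.single (trace_of E (replicate j v)) (c' j)"
    using assms(2) by (auto simp: power_like_def)
  define c'' where "c'' = (\<lambda>j. \<Sum>i=0..j. c i * c' (j - i))"
  have "(f * f') $ j = Poly_Mapping.single (trace_of E (replicate j v)) (c'' j)" for j
    unfolding fps_mult_nth c''_def single_sum
    by (rule sum.cong) (auto simp: c(3) c'(3) mult_single trace_of_replicate_add)
  moreover have "c'' 0 = 1" "c'' 1 = e + e'"
    using c c' by (simp_all add: c''_def)
  ultimately show ?thesis unfolding power_like_def by blast
qed

lemma power_like_generator: "power_like E v 1 (magnus E unit_weight [(v, True)])"
  unfolding power_like_def
  by (rule exI[of _ "\<lambda>j. if j \<le> 1 then 1 else 0"])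
    (auto simp: magnus_def generator_series_def)

lemma power_like_inverse: "power_like E v (-1) (magnus E unit_weight [(v, False)])"
proof -
  let ?f = "magnus E unit_weight [(v, False)]"
  have "?f $ j = Poly_Mapping.single (trace_of E (replicate j v)) ((-1) ^ j)" for j
  proof (induction j)
    case (Suc j)
    have "?f $ Suc j = - Poly_Mapping.single (trace_letter E v) 1 * ?f $ j"
      by (subst magnus_False_nth) auto
    then show ?case using Suc by (simp add: mult_single single_uminus)
  qed simp
  then show ?thesis unfolding power_like_def by (intro exI[of _ "\<lambda>j. (-1) ^ j"]) simp
qed

lemma power_like_int_pow:
  assumes "v \<in> V" "Relation.sym E" "irrefl E"
  shows "power_like E v e (magnus_class E unit_weight (generator E V v [^]\<^bsub>Raag E V\<^esub> (e::int)))"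
    (is "power_like E v e (?\<mu> (?g [^]\<^bsub>?G\<^esub> e))")
proof -
  interpret group ?G by (rule group_presented_group)
  have g: "?g \<in> carrier ?G" and g': "inv\<^bsub>?G\<^esub> ?g \<in> carrier ?G"
    using assms by auto
  have \<mu>: "power_like E v 1 (?\<mu> ?g)" "power_like E v (-1) (?\<mu> (inv\<^bsub>?G\<^esub> ?g))"
    using assms power_like_generator power_like_inverse
    by (simp_all add: inv_generator magnus_class_word_class)
  show ?thesis
  proof (induction e rule: int_induct[where k = 0])
    case base
    have "power_like E v 0 (1 :: ('a trace \<Rightarrow>\<^sub>0 int) fps)"
      unfolding power_like_def by (rule exI[of _ "\<lambda>j. if j = 0 then 1 else 0"]) auto
    then show ?case
      using assms by (simp add: one_presented_group magnus_class_word_class)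
  next
    case (step1 i)
    have "?g [^]\<^bsub>?G\<^esub> (i + 1) = ?g [^]\<^bsub>?G\<^esub> i \<otimes>\<^bsub>?G\<^esub> ?g"
      using int_pow_mult[OF g, of i 1] int_pow_1[OF g] by simp
    then show ?case
      using power_like_times[OF step1(2) \<mu>(1)] g assms by (simp add: magnus_class_mult)
  next
    case (step2 i)
    have "?g [^]\<^bsub>?G\<^esub> (i - 1) = ?g [^]\<^bsub>?G\<^esub> i \<otimes>\<^bsub>?G\<^esub> inv\<^bsub>?G\<^esub> ?g"
      using int_pow_diff[OF g, of i 1] int_pow_1[OF g] by simp
    then show ?case
      using power_like_times[OF step2(2) \<mu>(2)] g g' assms by (simp add: magnus_class_mult)
  qed
qed

text \<open>
  The traces of words with two equal adjacent letters absorb products, so modulo their span only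
  the linear terms of the factors contribute to the coefficient whose degree is the number of
  syllables.
\<close>

definition square_traces :: "('a \<times> 'a) set \<Rightarrow> 'a trace set" where
  "square_traces E = {trace_of E (x @ [v, v] @ y) | x v y. True}"

lemma square_traces_absorb:
  assumes "m \<in> square_traces E"
  shows "trace_of E w + m \<in> square_traces E" "m + trace_of E w \<in> square_traces E"
proof -
  obtain x v y where m: "m = trace_of E (x @ [v, v] @ y)"
    using assms by (auto simp: square_traces_def)
  have "trace_of E w + m = trace_of E ((w @ x) @ [v, v] @ y)"
    "m + trace_of E w = trace_of E (x @ [v, v] @ (y @ w))"
    using m by (simp_all add: add.assoc)
  then show "trace_of E w + m \<in> square_traces E" "m + trace_of E w \<in> square_traces E"
    unfolding square_traces_def by blast+
qed

lemma keys_times_square_traces: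
  assumes "keys p \<subseteq> range (trace_of E)" "keys q \<subseteq> square_traces E"
  shows "keys (p * q) \<subseteq> square_traces E" "keys (q * p) \<subseteq> square_traces E"
  by (rule keys_timesI, use assms square_traces_absorb in blast)+

lemma magnus_syllable_product:
  fixes F :: "'a \<times> int \<Rightarrow> ('a trace \<Rightarrow>\<^sub>0 int) fps"
  defines "P S \<equiv> prod_list (map F S)"
  assumes "\<forall>s\<in>set S. power_like E (fst s) (snd s) (F s)"
  shows "(\<forall>j. keys (P S $ j) \<subseteq> range (trace_of E)) \<and>
    (\<forall>j>length S. keys (P S $ j) \<subseteq> square_traces E) \<and>
    keys (P S $ length S - Poly_Mapping.single (trace_of E (map fst S)) (prod_list (map snd S)))
      \<subseteq> square_traces E"
  using assms(2)
proof (induction S)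
  case Nil
  have "0 \<in> range (trace_of E)" by (metis rangeI trace_of_simps(1))
  then show ?case by (auto simp: P_def)
next
  case (Cons s S)
  obtain v e where s: "s = (v, e)" by fastforce
  let ?n = "length S" and ?SQ = "square_traces E"
  have IH: "\<And>j. keys (P S $ j) \<subseteq> range (trace_of E)" "\<And>j. j > ?n \<Longrightarrow> keys (P S $ j) \<subseteq> ?SQ"
    "keys (P S $ ?n - Poly_Mapping.single (trace_of E (map fst S)) (prod_list (map snd S))) \<subseteq> ?SQ"
    using Cons by auto
  obtain c where c: "c 0 = 1" "c 1 = e"
      "\<And>j. F s $ j = Poly_Mapping.single (trace_of E (replicate j v)) (c j)"
    using Cons.prems s by (auto simp: power_like_def)
  have PS: "P (s # S) = F s * P S" by (simp add: P_def)
  have kF: "keys (F s $ j) \<subseteq> range (trace_of E)" for j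
    by (simp add: c(3))
  have kF2: "keys (F s $ j) \<subseteq> ?SQ" if "j \<ge> 2" for j
  proof -
    obtain i where "j = Suc (Suc i)" using \<open>j \<ge> 2\<close> by (metis add_2_eq_Suc le_Suc_ex)
    then have "replicate j v = [] @ [v, v] @ replicate i v" by simp
    then have "trace_of E (replicate j v) \<in> ?SQ"
      unfolding square_traces_def by (intro CollectI exI conjI TrueI arg_cong[where f = "trace_of E"])
    then show ?thesis unfolding c(3) by simp
  qed
  have 1: "keys (P (s # S) $ j) \<subseteq> range (trace_of E)" for j
  proof -
    have "keys (F s $ i * P S $ (j - i)) \<subseteq> range (trace_of E)" for i
    proof (rule keys_timesI)
      fix a b assume "a \<in> keys (F s $ i)" "b \<in> keys (P S $ (j - i))"
      then obtain x y where "a = trace_of E x" "b = trace_of E y" using kF IH(1) by blast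
      then show "a + b \<in> range (trace_of E)" by (metis rangeI trace_of_simps(3))
    qed
    then show ?thesis unfolding PS fps_mult_nth
      using keys_sum[of "\<lambda>i. F s $ i * P S $ (j - i)" "{0..j}"] by blast
  qed
  have lead: "keys (P (s # S) $ Suc j - Poly_Mapping.single (trace_letter E v) e * P S $ j) \<subseteq> ?SQ"
    if "j \<ge> ?n" for j
  proof -
    have "P (s # S) $ Suc j = (\<Sum>i\<in>{0, 1} \<union> {2..Suc j}. F s $ i * P S $ (Suc j - i))"
      unfolding PS fps_mult_nth by (rule sum.cong) auto
    also have "\<dots> = P S $ Suc j + Poly_Mapping.single (trace_letter E v) e * P S $ j +
        (\<Sum>i=2..Suc j. F s $ i * P S $ (Suc j - i))"
      using c(2) by (subst sum.union_disjoint) (auto simp: c(1,3))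
    finally have "P (s # S) $ Suc j - Poly_Mapping.single (trace_letter E v) e * P S $ j =
        P S $ Suc j + (\<Sum>i=2..Suc j. F s $ i * P S $ (Suc j - i))" by simp
    moreover have "keys (\<Sum>i=2..Suc j. F s $ i * P S $ (Suc j - i)) \<subseteq> ?SQ"
      using keys_sum[of "\<lambda>i. F s $ i * P S $ (Suc j - i)" "{2..Suc j}"]
        keys_times_square_traces(2)[OF IH(1) kF2] by fastforce
    ultimately show ?thesis
      using keys_add[of "P S $ Suc j" "\<Sum>i=2..Suc j. F s $ i * P S $ (Suc j - i)"] IH(2)[of "Suc j"] that
      by auto
  qed
  have kl: "keys (Poly_Mapping.single (trace_letter E v) e) \<subseteq> range (trace_of E)"
    using kF[of 1] c by simp
  have add_SQ: "keys p \<subseteq> ?SQ" if "keys (p - q) \<subseteq> ?SQ" "keys q \<subseteq> ?SQ" for p q :: "'a trace \<Rightarrow>\<^sub>0 int"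
    using that keys_add[of "p - q" q] by auto
  have 2: "keys (P (s # S) $ j) \<subseteq> ?SQ" if "j > length (s # S)" for j
  proof -
    obtain i where i: "j = Suc i" "i > ?n"
      using \<open>j > length (s # S)\<close> by (cases j) auto
    show ?thesis
      using add_SQ[OF lead[of i]] keys_times_square_traces(1)[OF kl IH(2)] i by auto
  qed
  have 3: "keys (P (s # S) $ length (s # S) -
      Poly_Mapping.single (trace_of E (map fst (s # S))) (prod_list (map snd (s # S)))) \<subseteq> ?SQ"
  proof -
    let ?q = "P S $ ?n - Poly_Mapping.single (trace_of E (map fst S)) (prod_list (map snd S))"
    let ?l = "Poly_Mapping.single (trace_letter E v) e"
    have "P (s # S) $ length (s # S) -
        Poly_Mapping.single (trace_of E (map fst (s # S))) (prod_list (map snd (s # S))) =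
        (P (s # S) $ Suc ?n - ?l * P S $ ?n) + ?l * ?q"
      by (simp add: s mult_single right_diff_distrib)
    moreover have "keys \<dots> \<subseteq> ?SQ"
      using lead[OF order_refl] keys_times_square_traces(1)[OF kl IH(3)]
      by (intro order_trans[OF keys_add] Un_least)
    ultimately show ?thesis by (simp only:)
  qed
  show ?case using 1 2 3 by blast
qed

text \<open>
  A word for the given element with the fewest syllables has no exponent \<open>0\<close>, and its letters
  cannot be rearranged so that two equal ones become adjacent, since these could be merged. Then the
  monomial formed by its letters has a non-zero coefficient, namely the product of the exponents.
\<close>

theorem magnus_faithful:
  assumes "Relation.sym E" "irrefl E" "w \<in> words W" "magnus E unit_weight w = 1"
  shows "(w, []) \<in> raag_rel E W"
proof -
  let ?G = "Raag E W" and ?g = "generator E W" and ?\<mu> = "magnus_class E unit_weight"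
  interpret group ?G by (rule group_presented_group)
  have g: "?g v \<in> carrier ?G" if "v \<in> W" for v using that by simp
  define rep where "rep S \<longleftrightarrow> fst ` set S \<subseteq> W \<and> syllable_product ?g S = word_class E W w" for S
  have "\<exists>S. fst ` set S \<subseteq> W \<and> syllable_product ?g S = word_class E W u" if "u \<in> words W" for u
    using that
  proof (induction u)
    case Nil
    then show ?case by (intro exI[of _ "[]"]) (simp add: one_presented_group)
  next
    case (Cons x u)
    obtain s b where x: "x = (s, b)" "s \<in> W" using Cons.prems by (cases x) auto
    obtain S where S: "fst ` set S \<subseteq> W" "syllable_product ?g S = word_class E W u"
      using Cons by auto
    have "?g s [^]\<^bsub>?G\<^esub> (if b then 1 else -1 :: int) = word_class E W [x]"
      using x g[OF x(2)] int_pow_neg[OF g[OF x(2)], of 1] int_pow_1[OF g[OF x(2)]]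
      by (simp add: inv_generator)
    then have "syllable_product ?g ((s, if b then 1 else -1) # S) = word_class E W (x # u)"
      using S Cons.prems by (simp add: mult_presented_group)
    then show ?case using S x by (intro exI[of _ "(s, if b then 1 else -1) # S"]) auto
  qed
  then have "\<exists>S. rep S" using assms(3) by (auto simp: rep_def)
  then obtain S where S: "rep S" "\<And>T. rep T \<Longrightarrow> length S \<le> length T"
    by (metis arg_min_nat_lemma)
  have gS: "\<forall>v\<in>fst ` set T. ?g v \<in> carrier ?G" if "fst ` set T \<subseteq> W" for T :: "('a \<times> int) list"
    using that g by auto
  have nz: "snd s \<noteq> 0" if "s \<in> set S" for s
  proof
    assume "snd s = 0"
    obtain X Y where XY: "S = X @ (fst s, 0) # Y"
      using split_list[OF \<open>s \<in> set S\<close>] \<open>snd s = 0\<close> by (cases s) auto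
    then have cl: "fst ` set X \<subseteq> W" "fst ` set Y \<subseteq> W" "fst s \<in> W"
      using S(1) by (auto simp: rep_def)
    have "syllable_product ?g (X @ Y) = syllable_product ?g S"
      using gS[OF cl(1)] gS[OF cl(2)] cl(3) g syllable_product_closed[OF gS[OF cl(2)]]
      by (simp add: XY syllable_product_append)
    then have "rep (X @ Y)" using S(1) cl by (auto simp: rep_def)
    then show False using S(2)[of "X @ Y"] XY by simp
  qed
  have nsq: "trace_of E (map fst S) \<notin> square_traces E"
  proof
    assume "trace_of E (map fst S) \<in> square_traces E"
    then obtain x v y where xy: "trace_of E (map fst S) = trace_of E (x @ [v, v] @ y)"
      by (auto simp: square_traces_def)
    have "\<exists>T. map fst T = x @ [v, v] @ y \<and> length T = length S \<and>
        syllable_product ?g T = syllable_product ?g S"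
      by (rule syllable_product_rearrange[where E = E and W = W])
        (use assms(1,2) g generators_commute[of _ _ E W] xy S(1) in \<open>simp_all only: rep_def\<close>)
    then obtain T where T: "map fst T = x @ [v, v] @ y" "length T = length S"
        "syllable_product ?g T = syllable_product ?g S"
      by blast
    obtain X Z where XZ: "T = X @ Z" "map fst X = x" "map fst Z = v # v # y"
      using T(1) by (auto simp: map_eq_append_conv)
    then obtain e e' Y where Y: "Z = (v, e) # (v, e') # Y" "map fst Y = y"
      by (auto simp: map_eq_Cons_conv)
    have "set (map fst S) = set (x @ [v, v] @ y)" by (rule set_trace_of_eq[OF xy assms(2)])
    then have "fst ` set S = insert v (fst ` set X \<union> fst ` set Y)"
      unfolding set_map [symmetric] XZ Y by auto
    then have cl: "fst ` set X \<subseteq> W" "fst ` set Y \<subseteq> W" "v \<in> W"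
      using S(1) by (simp_all add: rep_def)
    have "syllable_product ?g (X @ (v, e + e') # Y) = syllable_product ?g T"
      using gS[OF cl(1)] gS[OF cl(2)] cl(3) g[OF cl(3)] syllable_product_closed[OF gS[OF cl(2)]]
      by (simp add: XZ Y syllable_product_append int_pow_mult m_assoc)
    then have "rep (X @ (v, e + e') # Y)"
      using S(1) T(3) cl by (simp add: rep_def image_Un)
    then show False using S(2) T(2) XZ Y by fastforce
  qed
  have "?\<mu> (syllable_product ?g T) = prod_list (map (\<lambda>(v, e). ?\<mu> (?g v [^]\<^bsub>?G\<^esub> e)) T)"
    if "fst ` set T \<subseteq> W" for T
    using that
  proof (induction T)
    case Nil
    then show ?case using assms by (simp add: one_presented_group magnus_class_word_class)
  next
    case (Cons t T)
    then show ?case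
      using assms(1,2) gS[of T] syllable_product_closed[of T ?g]
      by (cases t) (auto simp: magnus_class_mult)
  qed
  from this[of S, symmetric] have one: "prod_list (map (\<lambda>(v, e). ?\<mu> (?g v [^]\<^bsub>?G\<^esub> e)) S) = 1"
    using S(1) assms by (simp add: rep_def magnus_class_word_class)
  have pl: "\<forall>s\<in>set S. power_like E (fst s) (snd s) ((\<lambda>(v, e). ?\<mu> (?g v [^]\<^bsub>?G\<^esub> e)) s)"
  proof
    fix s assume "s \<in> set S"
    then have "fst s \<in> W" using S(1) by (auto simp: rep_def)
    from power_like_int_pow[OF this assms(1,2)]
    show "power_like E (fst s) (snd s) ((\<lambda>(v, e). ?\<mu> (?g v [^]\<^bsub>?G\<^esub> e)) s)"
      by (simp add: case_prod_unfold)
  qed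
  have "keys (1 $ length S - Poly_Mapping.single (trace_of E (map fst S)) (prod_list (map snd S)))
      \<subseteq> square_traces E"
    using magnus_syllable_product[OF pl] unfolding one by blast
  then have "lookup (1 $ length S - Poly_Mapping.single (trace_of E (map fst S)) (prod_list (map snd S)))
      (trace_of E (map fst S)) = 0"
    using nsq by (meson in_keys_iff subsetD)
  moreover have "prod_list (map snd S) \<noteq> 0" using nz by (auto simp: prod_list_zero_iff)
  ultimately have "S = []"
    by (cases S) (auto simp: lookup_minus)
  then have "word_class E W w = word_class E W []"
    using S(1) by (simp add: rep_def one_presented_group)
  then show ?thesis using assms(3) by (simp add: pres_class_eq_iff)
qed

section \<open>Lowest terms of the Magnus expansion\<close>

definition exponent_sum :: "'a \<Rightarrow> 'a word \<Rightarrow> int" where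
  "exponent_sum u w = (\<Sum>(s, b)\<leftarrow>w. if s = u then if b then 1 else -1 else 0)"

lemma exponent_sum_simps [simp]:
  "exponent_sum u [] = 0"
  "exponent_sum u ((s, b) # w) = (if s = u then if b then 1 else -1 else 0) + exponent_sum u w"
  "exponent_sum u (w @ w') = exponent_sum u w + exponent_sum u w'"
  by (simp_all add: exponent_sum_def)

lemma exponent_sum_filter:
  "exponent_sum u (filter (\<lambda>x. fst x \<notin> C) w) = (if u \<in> C then 0 else exponent_sum u w)"
  by (induction w) auto

lemma exponent_sum_cong:
  assumes "(v, w) \<in> raag_rel E V"
  shows "exponent_sum u v = exponent_sum u w"
  using assms by (induction rule: pres_rel.induct) (auto simp: commutator_word_def)

definition linear_form :: "('a \<times> 'a) set \<Rightarrow> 'a set \<Rightarrow> ('a \<Rightarrow> int) \<Rightarrow> 'a trace \<Rightarrow>\<^sub>0 int" where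
  "linear_form E C y = (\<Sum>u\<in>C. Poly_Mapping.single (trace_letter E u) (y u))"

lemma linear_form_cong:
  "(\<And>u. u \<in> C \<Longrightarrow> x u = y u) \<Longrightarrow> linear_form E C x = linear_form E C y"
  by (simp add: linear_form_def)

lemma linear_form_zero [simp]: "linear_form E C (\<lambda>_. 0) = 0"
  by (simp add: linear_form_def)

lemma linear_form_add:
  "linear_form E C (\<lambda>u. x u + y u) = linear_form E C x + linear_form E C y"
  by (simp add: linear_form_def single_add sum.distrib)

lemma linear_form_delta:
  "finite C \<Longrightarrow> linear_form E C (\<lambda>u. if u = l then N else 0) =
    (if l \<in> C then Poly_Mapping.single (trace_letter E l) N else 0)"
  by (simp add: linear_form_def if_distrib [of "Poly_Mapping.single _"] sum.delta cong: if_cong)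

lemma of_int_times_single:
  "of_int c * Poly_Mapping.single k (y::int) = Poly_Mapping.single k (c * y)" for k :: "'a trace"
  using mult_single[of 0 c k y] by (simp flip: single_of_int)

lemma linear_form_combination:
  "(\<Sum>w\<in>I. of_int (c w) * linear_form E C (y w)) = linear_form E C (\<lambda>u. \<Sum>w\<in>I. c w * y w u)"
  unfolding linear_form_def sum_distrib_left of_int_times_single single_sum
  by (rule sum.swap)

lemma keys_linear_form: "keys (linear_form E C y) \<subseteq> trace_letter E ` C"
  unfolding linear_form_def using keys_sum[of "\<lambda>u. Poly_Mapping.single (trace_letter E u) (y u)" C]
  by (auto split: if_splits)

lemma magnus_letter_nth:
  assumes "d s > 0"
  shows "i < d s \<Longrightarrow> magnus E d [(s, b)] $ i = (if i = 0 then 1 else 0)"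
    and "magnus E d [(s, b)] $ d s = Poly_Mapping.single (trace_letter E s) (if b then 1 else -1)"
  using assms magnus_False_nth[of _ d s E]
  by (cases b; simp add: magnus_def generator_series_def single_uminus)+

text \<open>
  The expansion of a letter in \<open>C\<close> has no terms of positive weight below \<open>k\<close>, so a term of weight at
  most \<open>k\<close> either has no letter in \<open>C\<close> or is a single such letter.
\<close>

lemma magnus_weighted_low_terms:
  assumes "finite C" "k \<ge> 1"
  defines "d \<equiv> \<lambda>s. if s \<in> C then k else 1"
  defines "r \<equiv> filter (\<lambda>x. fst x \<notin> C)"
  shows "(\<forall>j<k. magnus E d w $ j = magnus E unit_weight (r w) $ j) \<and>
    magnus E d w $ k =
      magnus E unit_weight (r w) $ k + linear_form E C (\<lambda>u. exponent_sum u w)"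
proof (induction w)
  case Nil
  then show ?case by (simp add: r_def)
next
  case (Cons x w)
  obtain s b where x: "x = (s, b)" by fastforce
  let ?P = "magnus E d w" and ?Q = "magnus E unit_weight (r w)" and ?f = "magnus E d [x]"
  have eq: "magnus E d (x # w) = ?f * ?P" by (rule magnus_Cons)
  have f0: "?f $ 0 = 1" by simp
  show ?case
  proof (cases "s \<in> C")
    case False
    then have "?f = magnus E unit_weight [x]"
      by (simp only: x magnus_def generator_series_def d_def if_False list.map prod.case)
    moreover have "r (x # w) = x # r w" using False x by (simp add: r_def)
    ultimately have eq': "magnus E unit_weight (r (x # w)) = ?f * ?Q"
      by (metis magnus_Cons)
    have "(?f * ?P) $ j = (?f * ?Q) $ j" if "j < k" for j
      unfolding fps_mult_nth by (rule sum.cong) (use Cons that in auto)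
    moreover have "(?f * ?P) $ k - ?f $ 0 * ?P $ k = (?f * ?Q) $ k - ?f $ 0 * ?Q $ k"
      unfolding fps_mult_nth
      by (subst (1 2) sum.atLeast_Suc_atMost) (use Cons in \<open>auto intro!: sum.cong\<close>)
    moreover have "linear_form E C (\<lambda>u. exponent_sum u (x # w)) = linear_form E C (\<lambda>u. exponent_sum u w)"
      using False x by (intro linear_form_cong) auto
    ultimately show ?thesis unfolding eq eq' using Cons f0 by (auto simp: algebra_simps)
  next
    case True
    have ds: "d s = k" using True by (simp add: d_def)
    have fi: "?f $ i = (if i = 0 then 1 else 0)" if "i < k" for i
      using magnus_letter_nth(1)[of d s i] that ds assms(2) x by simp
    have fk: "?f $ k = Poly_Mapping.single (trace_letter E s) (if b then 1 else -1)"
      using magnus_letter_nth(2)[of d s E b] ds assms(2) x by simp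
    have "(?f * ?P) $ j = (\<Sum>i=0..j. if i = 0 then ?P $ j else 0)" if "j < k" for j
      unfolding fps_mult_nth by (rule sum.cong) (use fi that in auto)
    then have lt: "(?f * ?P) $ j = ?P $ j" if "j < k" for j
      using that by simp
    have "(?f * ?P) $ k = (\<Sum>i=0..k. (if i = 0 then ?P $ k else 0) + (if i = k then ?f $ k else 0))"
      unfolding fps_mult_nth by (rule sum.cong) (use fi assms(2) in \<open>auto simp: le_less\<close>)
    then have eqk: "(?f * ?P) $ k = ?P $ k + ?f $ k"
      by (simp add: sum.distrib)
    have "linear_form E C (\<lambda>u. exponent_sum u (x # w)) =
        linear_form E C (\<lambda>u. exponent_sum u w) +
        linear_form E C (\<lambda>u. if u = s then if b then 1 else -1 else 0)"
      unfolding linear_form_add [symmetric] by (rule linear_form_cong) (simp add: x)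
    also have "linear_form E C (\<lambda>u. if u = s then if b then 1 else -1 else 0) = ?f $ k"
      using linear_form_delta[OF assms(1), of E s "if b then 1 else -1"] True fk by simp
    finally have "linear_form E C (\<lambda>u. exponent_sum u (x # w)) =
        linear_form E C (\<lambda>u. exponent_sum u w) + ?f $ k" .
    moreover have "r (x # w) = r w" using True x by (simp add: r_def)
    ultimately show ?thesis using Cons unfolding eq by (auto simp: lt eqk)
  qed
qed

text \<open>If all letters have weight \<open>k = 1\<close>, only the exponent sums are left in degree one.\<close>

corollary magnus_nth_1:
  assumes "finite V" "w \<in> words V"
  shows "magnus E unit_weight w $ 1 = linear_form E V (\<lambda>u. exponent_sum u w)"
proof -
  have "filter (\<lambda>x. fst x \<notin> V) w = []"
    using assms(2) by (auto simp: words_def filter_empty_conv)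
  then show ?thesis
    using magnus_weighted_low_terms[OF assms(1), of 1 E w] by simp
qed

definition homogeneous_traces :: "('a \<times> 'a) set \<Rightarrow> 'a set \<Rightarrow> nat \<Rightarrow> 'a trace set" where
  "homogeneous_traces E W n = {trace_of E u | u. set u \<subseteq> W \<and> length u = n}"

lemma keys_magnus_nth:
  assumes "w \<in> words W"
  shows "keys (magnus E unit_weight w $ n) \<subseteq> homogeneous_traces E W n"
  using assms
proof (induction w arbitrary: n)
  case Nil
  have "0 \<in> homogeneous_traces E W 0"
    unfolding homogeneous_traces_def by (auto intro!: exI[of _ "[]"])
  then show ?case by simp
next
  case (Cons x w)
  obtain s b where x: "x = (s, b)" "s \<in> W" using Cons.prems by (cases x) auto
  let ?f = "magnus E unit_weight [x]" and ?P = "magnus E unit_weight w"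
  have f: "keys (?f $ i) \<subseteq> {trace_of E (replicate i s)}" for i
  proof -
    have "power_like E s (if b then 1 else -1) ?f"
      using power_like_generator[of E s] power_like_inverse[of E s] x by simp
    then obtain c where "?f $ i = Poly_Mapping.single (trace_of E (replicate i s)) (c i)"
      by (auto simp: power_like_def)
    then show ?thesis by simp
  qed
  have "keys (?f $ i * ?P $ (n - i)) \<subseteq> homogeneous_traces E W n" if "i \<le> n" for i
  proof (rule keys_timesI)
    fix a b assume "a \<in> keys (?f $ i)" "b \<in> keys (?P $ (n - i))"
    moreover from this obtain u where "b = trace_of E u" "set u \<subseteq> W" "length u = n - i"
      using Cons unfolding homogeneous_traces_def by fastforce
    ultimately have "a + b = trace_of E (replicate i s @ u)" "set (replicate i s @ u) \<subseteq> W"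
        "length (replicate i s @ u) = n"
      using f x that by auto
    then show "a + b \<in> homogeneous_traces E W n" unfolding homogeneous_traces_def by blast
  qed
  then show ?case
    unfolding magnus_Cons[of E unit_weight x w] fps_mult_nth
    using keys_sum[of "\<lambda>i. ?f $ i * ?P $ (n - i)" "{0..n}"] by fastforce
qed

section \<open>Elements of the trace ring that commute\<close>

lemma filter_eq_of_trace_of_eq:
  assumes "trace_of E u = trace_of E u'" "(p, q) \<notin> E"
  shows "filter (\<lambda>a. a = p \<or> a = q) u = filter (\<lambda>a. a = p \<or> a = q) u'"
  using projection_trace_of[of E u p q] projection_trace_of[of E u' p q] assms by simp

lemma lookup_linear_form_times:
  assumes "finite V" "a \<in> V" "b \<in> V" "a \<noteq> b" "(a, b) \<notin> E"
  shows "lookup (linear_form E V x * linear_form E V y) (trace_of E [a, b]) = x a * y b"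
proof -
  have eq: "trace_letter E u + trace_letter E t = trace_of E [a, b] \<longleftrightarrow> u = a \<and> t = b" for u t
  proof
    assume "trace_letter E u + trace_letter E t = trace_of E [a, b]"
    then have "trace_of E [u, t] = trace_of E [a, b]" by simp
    from filter_eq_of_trace_of_eq[OF this assms(5)] show "u = a \<and> t = b"
      by (auto split: if_splits)
  qed simp
  have "lookup (linear_form E V x * linear_form E V y) (trace_of E [a, b]) =
      (\<Sum>u\<in>V. \<Sum>t\<in>V. if u = a \<and> t = b then x u * y t else 0)"
    unfolding linear_form_def sum_product mult_single lookup_sum lookup_single when_def eq ..
  also have "\<dots> = (\<Sum>u\<in>V. if u = a then \<Sum>t\<in>V. if t = b then x u * y t else 0 else 0)"
    by (rule sum.cong) auto
  also have "\<dots> = x a * y b" using assms by simp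
  finally show ?thesis .
qed

text \<open>
  Comparing coefficients at the monomials in which one letter from \<open>C\<close> stands to the right of a
  non-commuting monomial in the other letters separates two commuting sums by their parts.
\<close>

lemma commuting_sums_coefficients:
  assumes "irrefl E" "finite C" "C \<inter> W = {}"
    and z: "keys z \<subseteq> trace_of E ` lists W" "keys z' \<subseteq> trace_of E ` lists W"
    and comm: "(z + linear_form E C x) * (z' + linear_form E C y) =
      (z' + linear_form E C y) * (z + linear_form E C x)"
    and a: "a \<in> C" and m: "m \<in> lists W" "b \<in> set m" "(b, a) \<notin> E"
  shows "y a * lookup z (trace_of E m) = x a * lookup z' (trace_of E m)"
proof -
  let ?K = "trace_of E (m @ [a])"
  have b: "b \<in> W" "b \<noteq> a" "a \<notin> set m" using m a assms(3) by (auto dest: in_listsD)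
  have zero: "lookup P ?K = 0"
    if "\<And>k. k \<in> keys P \<Longrightarrow> \<exists>u. k = trace_of E u \<and> set u \<noteq> set (m @ [a])" for P
    using that[of ?K] set_trace_of_eq[OF _ assms(1)] by (metis in_keys_iff)
  have ll: "lookup (linear_form E C f * linear_form E C g) ?K = 0" for f g
  proof (rule zero)
    fix k assume "k \<in> keys (linear_form E C f * linear_form E C g)"
    then obtain u t where "u \<in> C" "t \<in> C" "k = trace_letter E u + trace_letter E t"
      using keys_linear_form by (blast elim: keys_timesE)
    then have "u \<in> C" "t \<in> C" "k = trace_of E [u, t]" by simp_all
    moreover from this have "b \<notin> set [u, t]" using b assms(3) by auto
    ultimately show "\<exists>u. k = trace_of E u \<and> set u \<noteq> set (m @ [a])" using m(2) by (metis UnI1 set_append)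
  qed
  have zz: "lookup (p * q) ?K = 0"
    if pq: "keys p \<subseteq> trace_of E ` lists W" "keys q \<subseteq> trace_of E ` lists W" for p q
  proof (rule zero)
    fix k assume "k \<in> keys (p * q)"
    then obtain u t where "u \<in> lists W" "t \<in> lists W" "k = trace_of E u + trace_of E t"
      using pq by (blast elim: keys_timesE)
    then have "u \<in> lists W" "t \<in> lists W" "k = trace_of E (u @ t)" by simp_all
    moreover from this have "a \<notin> set (u @ t)" using a assms(3) by (auto dest: in_listsD)
    ultimately show "\<exists>u. k = trace_of E u \<and> set u \<noteq> set (m @ [a])" by fastforce
  qed
  have lz: "lookup (linear_form E C f * p) ?K = 0" if p: "keys p \<subseteq> trace_of E ` lists W" for f p
  proof (rule ccontr)
    assume "lookup (linear_form E C f * p) ?K \<noteq> 0"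
    then have "?K \<in> keys (linear_form E C f * p)" by (simp add: in_keys_iff)
    then obtain u t where "u \<in> C" "t \<in> lists W" "?K = trace_letter E u + trace_of E t"
      using keys_linear_form p by (blast elim: keys_timesE)
    then have ut: "u \<in> C" "t \<in> lists W" "?K = trace_of E (u # t)" by simp_all
    have "u = a" using set_trace_of_eq[OF ut(3) assms(1)] ut a assms(3) by (auto dest: in_listsD)
    moreover have "filter (\<lambda>c. c = b \<or> c = a) (m @ [a]) = filter (\<lambda>c. c = b \<or> c = a) (u # t)"
      using filter_eq_of_trace_of_eq[OF ut(3) m(3)] .
    moreover have "filter (\<lambda>c. c = b \<or> c = a) m \<noteq> []" using m(2) by (auto simp: filter_empty_conv)
    moreover have "a \<notin> set (filter (\<lambda>c. c = b \<or> c = a) m)" using b by simp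
    ultimately show False by (cases "filter (\<lambda>c. c = b \<or> c = a) m") auto
  qed
  have zl: "lookup (p * linear_form E C f) ?K = lookup p (trace_of E m) * f a"
    if p: "keys p \<subseteq> trace_of E ` lists W" for f p
  proof -
    have "lookup (p * Poly_Mapping.single (trace_letter E u) (f u)) ?K =
        (if u = a then lookup p (trace_of E m) * f a else 0)" if "u \<in> C" for u
    proof (cases "u = a")
      case True
      then show ?thesis by (simp add: lookup_times_single_right)
    next
      case False
      have "lookup (p * Poly_Mapping.single (trace_letter E u) (f u)) ?K = 0"
      proof (rule zero)
        fix k assume "k \<in> keys (p * Poly_Mapping.single (trace_letter E u) (f u))"
        then obtain k1 k2 where "k = k1 + k2" "k1 \<in> keys p"
            "k2 \<in> keys (Poly_Mapping.single (trace_letter E u) (f u))"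
          by (rule keys_timesE)
        then obtain t where "t \<in> lists W" "k = trace_of E t + trace_letter E u"
          using p subsetD[OF keys_single_subset, of k2] by blast
        then have "t \<in> lists W" "k = trace_of E (t @ [u])" by simp_all
        moreover from this have "a \<notin> set (t @ [u])" using False a assms(3) by (auto dest: in_listsD)
        ultimately show "\<exists>u. k = trace_of E u \<and> set u \<noteq> set (m @ [a])" by fastforce
      qed
      then show ?thesis using False by simp
    qed
    then have "lookup (p * linear_form E C f) ?K =
        (\<Sum>u\<in>C. if u = a then lookup p (trace_of E m) * f a else 0)"
      unfolding linear_form_def sum_distrib_left lookup_sum by (rule sum.cong[OF HOL.refl])
    then show ?thesis using assms(2) a by simp
  qed
  have "lookup ((z + linear_form E C x) * (z' + linear_form E C y)) ?K = lookup z (trace_of E m) * y a"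
    using ll zz[OF z] lz[OF z(2)] zl[OF z(1)] by (simp add: distrib_left distrib_right lookup_add)
  moreover have "lookup ((z' + linear_form E C y) * (z + linear_form E C x)) ?K =
      lookup z' (trace_of E m) * x a"
    using ll zz[OF z(2,1)] lz[OF z(1)] zl[OF z(2)] by (simp add: distrib_left distrib_right lookup_add)
  ultimately show ?thesis using comm by (simp add: mult.commute)
qed

text \<open>
  If \<open>z l = l z\<close>, then for every monomial \<open>m\<close> of \<open>z\<close> there is another one \<open>m'\<close> with
  \<open>m l = l m'\<close>. In the projection to \<open>l\<close> and a letter that does not commute with \<open>l\<close> this removes
  a leading \<open>l\<close>, which cannot go on forever.
\<close>

lemma letters_commute_with_centralized_letter:
  assumes "irrefl E" "C \<inter> W = {}" "l \<in> W" "N \<noteq> 0"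
    and z: "keys z \<subseteq> trace_of E ` lists W"
    and comm: "(z + linear_form E C x) * Poly_Mapping.single (trace_letter E l) N =
      Poly_Mapping.single (trace_letter E l) N * (z + linear_form E C x)"
    and "m \<in> lists W" "trace_of E m \<in> keys z" "b \<in> set m"
  shows "b = l \<or> (b, l) \<in> E"
proof (rule ccontr)
  let ?l = "Poly_Mapping.single (trace_letter E l) N"
  let ?F = "filter (\<lambda>c. c = b \<or> c = l)"
  assume "\<not> (b = l \<or> (b, l) \<in> E)"
  then have b: "b \<noteq> l" "(b, l) \<notin> E" by auto
  have zero: "lookup (linear_form E C x * ?l) (trace_of E u) = 0"
    "lookup (?l * linear_form E C x) (trace_of E u) = 0" if "u \<in> lists W" for u
  proof -
    have "k \<noteq> trace_of E u" if kk: "k \<in> keys (linear_form E C x * ?l) \<or> k \<in> keys (?l * linear_form E C x)" for k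
    proof
      assume k: "k = trace_of E u"
      obtain c where "c \<in> C"
          "k = trace_letter E c + trace_letter E l \<or> k = trace_letter E l + trace_letter E c"
      proof (cases "k \<in> keys (linear_form E C x * ?l)")
        case True
        then obtain k1 k2 where "k = k1 + k2" "k1 \<in> keys (linear_form E C x)" "k2 \<in> keys ?l"
          by (rule keys_timesE)
        then show ?thesis
          using that keys_linear_form[of E C x] subsetD[OF keys_single_subset, of k2] by blast
      next
        case False
        then have "k \<in> keys (?l * linear_form E C x)" using kk by blast
        then obtain k1 k2 where "k = k1 + k2" "k1 \<in> keys ?l" "k2 \<in> keys (linear_form E C x)"
          by (rule keys_timesE)
        then show ?thesis
          using that keys_linear_form[of E C x] subsetD[OF keys_single_subset, of k1] by blast
      qed
      then have "c \<in> C" "k = trace_of E [c, l] \<or> k = trace_of E [l, c]" by simp_all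
      then have "c \<in> set u" using k set_trace_of_eq[OF _ assms(1)] by fastforce
      then show False using \<open>c \<in> C\<close> \<open>u \<in> lists W\<close> assms(2) by (auto dest: in_listsD)
    qed
    then show "lookup (linear_form E C x * ?l) (trace_of E u) = 0"
      "lookup (?l * linear_form E C x) (trace_of E u) = 0" by (auto simp: in_keys_iff)
  qed
  have False if "m \<in> lists W" "trace_of E m \<in> keys z" "b \<in> set m" for m
    using that
  proof (induction "length (takeWhile (\<lambda>c. c = l) (?F m))" arbitrary: m rule: less_induct)
    case less
    have ml: "m @ [l] \<in> lists W" using less.prems assms(3) by auto
    have "lookup ((z + linear_form E C x) * ?l) (trace_of E (m @ [l])) \<noteq> 0"
      using less.prems(2) assms(4) zero(1)[OF ml] lookup_times_single_right[of z "trace_letter E l" N]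
      by (simp add: distrib_right lookup_add in_keys_iff)
    then have "lookup (?l * z) (trace_of E (m @ [l])) \<noteq> 0"
      unfolding comm using zero(2)[OF ml] by (simp add: distrib_left lookup_add)
    then have "trace_of E (m @ [l]) \<in> keys (?l * z)" by (simp add: in_keys_iff)
    then obtain k1 k2 where "trace_of E (m @ [l]) = k1 + k2" "k1 \<in> keys ?l" "k2 \<in> keys z"
      by (rule keys_timesE)
    then obtain m' where "m' \<in> lists W" "trace_of E m' \<in> keys z"
        "trace_of E (m @ [l]) = trace_letter E l + trace_of E m'"
      using z subsetD[OF keys_single_subset, of k1] by blast
    then have m': "m' \<in> lists W" "trace_of E m' \<in> keys z" "trace_of E (m @ [l]) = trace_of E (l # m')"
      by simp_all
    have F: "?F m @ [l] = l # ?F m'"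
      using filter_eq_of_trace_of_eq[OF m'(3) b(2)] by simp
    have bF: "b \<in> set (?F m)" using less.prems(3) by simp
    then obtain q where q: "?F m = l # q" "?F m' = q @ [l]"
      using F by (cases "?F m") auto
    have bq: "b \<in> set q" using bF q(1) b(1) by simp
    then have "takeWhile (\<lambda>c. c = l) (q @ [l]) = takeWhile (\<lambda>c. c = l) q"
      using b(1) by (intro takeWhile_append1) auto
    then have "length (takeWhile (\<lambda>c. c = l) (?F m')) < length (takeWhile (\<lambda>c. c = l) (?F m))"
      using q by simp
    moreover have "b \<in> set m'" using bq q(2) by (metis Un_iff filter_is_subset set_append subset_iff)
    ultimately show False using less.hyps m' by blast
  qed
  then show False using assms by blast
qed

section \<open>Homogeneous linear systems over the integers\<close>

text \<open>
  Eliminating one unknown per equation without dividing keeps the system over the integers.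
\<close>

lemma homogeneous_system_nontrivial_solution:
  fixes a :: "'i \<Rightarrow> 'j \<Rightarrow> int"
  assumes "finite J" "finite I" "card J < card I"
  shows "\<exists>c. (\<exists>i\<in>I. c i \<noteq> 0) \<and> (\<forall>j\<in>J. (\<Sum>i\<in>I. c i * a i j) = 0)"
  using assms
proof (induction J arbitrary: I a rule: finite_induct)
  case empty
  then obtain i where "i \<in> I" by fastforce
  then show ?case by (intro exI[of _ "\<lambda>_. 1"]) auto
next
  case (insert j J)
  show ?case
  proof (cases "\<forall>i\<in>I. a i j = 0")
    case True
    obtain c where "\<exists>i\<in>I. c i \<noteq> 0" "\<forall>j\<in>J. (\<Sum>i\<in>I. c i * a i j) = 0"
      using insert.IH[of I a] insert.prems insert.hyps by auto
    then show ?thesis using True by (intro exI[of _ c]) simp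
  next
    case False
    then obtain k where k: "k \<in> I" "a k j \<noteq> 0" by blast
    define I' where "I' = I - {k}"
    have I': "I = insert k I'" "k \<notin> I'" "finite I'" using k insert.prems by (auto simp: I'_def)
    obtain c where c: "\<exists>i\<in>I'. c i \<noteq> 0"
        "\<forall>j'\<in>J. (\<Sum>i\<in>I'. c i * (a k j * a i j' - a i j * a k j')) = 0"
      using insert.IH[of I' "\<lambda>i j'. a k j * a i j' - a i j * a k j'"] insert.prems insert.hyps I'
      by auto
    define c' where "c' i = (if i = k then - (\<Sum>i\<in>I'. c i * a i j) else c i * a k j)" for i
    have sum: "(\<Sum>i\<in>I. c' i * a i j') = (\<Sum>i\<in>I'. c i * (a k j * a i j' - a i j * a k j'))" for j'
    proof -
      have "(\<Sum>i\<in>I. c' i * a i j') = c' k * a k j' + (\<Sum>i\<in>I'. c' i * a i j')"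
        using I' by simp
      also have "(\<Sum>i\<in>I'. c' i * a i j') = (\<Sum>i\<in>I'. c i * a k j * a i j')"
        by (rule sum.cong) (use I'(2) in \<open>auto simp: c'_def\<close>)
      also have "c' k * a k j' + (\<Sum>i\<in>I'. c i * a k j * a i j') =
          (\<Sum>i\<in>I'. c i * a k j * a i j') - (\<Sum>i\<in>I'. c i * a i j * a k j')"
        by (simp add: c'_def sum_distrib_right)
      also have "\<dots> = (\<Sum>i\<in>I'. c i * (a k j * a i j' - a i j * a k j'))"
        by (simp add: sum_subtractf [symmetric] right_diff_distrib mult.assoc)
      finally show ?thesis .
    qed
    have "\<forall>j'\<in>insert j J. (\<Sum>i\<in>I. c' i * a i j') = 0"
      using c(2) by (auto simp: sum algebra_simps)
    moreover have "\<exists>i\<in>I. c' i \<noteq> 0" using c(1) k I' by (auto simp: c'_def)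
    ultimately show ?thesis by blast
  qed
qed

text \<open>
  The coefficients of \<open>f g\<close> and \<open>g f\<close> at \<open>X\<^bsup>k + n\<^esup>\<close> differ only in the order of the product of the
  leading coefficients.
\<close>

lemma leading_coefficients_commute:
  fixes f g :: "'r::ring_1 fps"
  assumes "f * g = g * f" "f $ 0 = 1" "g $ 0 = 1" "k > 0" "n > 0"
    and "\<And>j. 0 < j \<Longrightarrow> j < k \<Longrightarrow> f $ j = 0" "\<And>j. 0 < j \<Longrightarrow> j < n \<Longrightarrow> g $ j = 0"
  shows "f $ k * g $ n = g $ n * f $ k"
proof -
  have *: "(f * g) $ (k + n) = f $ (k + n) + g $ (k + n) + f $ k * g $ n"
    if "f $ 0 = 1" "g $ 0 = 1" "k > 0" "n > 0"
      "\<And>j. 0 < j \<Longrightarrow> j < k \<Longrightarrow> f $ j = 0" "\<And>j. 0 < j \<Longrightarrow> j < n \<Longrightarrow> g $ j = 0"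
    for f g :: "'r fps" and k n
  proof -
    have "f $ i * g $ (k + n - i) = (if i = 0 then g $ (k + n) else 0) +
        (if i = k then f $ k * g $ n else 0) + (if i = k + n then f $ (k + n) else 0)"
      if "i \<le> k + n" for i
      using that \<open>f $ 0 = 1\<close> \<open>g $ 0 = 1\<close> \<open>k > 0\<close> \<open>n > 0\<close>
        \<open>\<And>j. 0 < j \<Longrightarrow> j < k \<Longrightarrow> f $ j = 0\<close>[of i] \<open>\<And>j. 0 < j \<Longrightarrow> j < n \<Longrightarrow> g $ j = 0\<close>[of "k + n - i"]
      by (cases "i = 0"; cases "i < k"; cases "i = k"; cases "i = k + n") auto
    then show ?thesis
      unfolding fps_mult_nth by (simp add: sum.distrib sum.delta add_ac)
  qed
  from *[of f g k n] *[of g f n k] show ?thesis using assms by (simp add: add_ac)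
qed

lemma integer_combination_commutes:
  fixes a :: "'r::ring_1"
  assumes "\<And>i. i \<in> I \<Longrightarrow> a * b i = b i * a"
  shows "a * (\<Sum>i\<in>I. of_int (c i) * b i) = (\<Sum>i\<in>I. of_int (c i) * b i) * a"
proof -
  have "a * (of_int (c i) * b i) = of_int (c i) * b i * a" if "i \<in> I" for i
  proof -
    have "a * (of_int (c i) * b i) = of_int (c i) * (a * b i)"
      by (metis mult.assoc mult_of_int_commute)
    then show ?thesis using assms[OF that] by (simp add: mult.assoc)
  qed
  then show ?thesis by (simp add: sum_distrib_left sum_distrib_right)
qed

section \<open>Automorphisms and vertices of maximal degree\<close>

text \<open>
  The words \<open>p v\<close> and \<open>q v\<close> represent the images of the generator \<open>v\<close> under an automorphism and its
  inverse. That these are mutually inverse is expressed by exponent sums, that is, in the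
  abelianization.
\<close>

locale inverse_substitutions =
  fixes E :: "('a \<times> 'a) set" and V :: "'a set" and p q :: "'a \<Rightarrow> 'a word"
  assumes sym_E: "Relation.sym E" and irrefl_E: "irrefl E" and finite_V: "finite V"
    and words_p: "v \<in> V \<Longrightarrow> p v \<in> words V"
    and words_q: "v \<in> V \<Longrightarrow> q v \<in> words V"
    and commute_p: "u \<in> V \<Longrightarrow> v \<in> V \<Longrightarrow> (u, v) \<in> E \<Longrightarrow> (p u @ p v, p v @ p u) \<in> raag_rel E V"
    and commute_q: "u \<in> V \<Longrightarrow> v \<in> V \<Longrightarrow> (u, v) \<in> E \<Longrightarrow> (q u @ q v, q v @ q u) \<in> raag_rel E V"
    and inverse_pq: "u \<in> V \<Longrightarrow> w \<in> V \<Longrightarrow>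
      (\<Sum>t\<in>V. exponent_sum t (q w) * exponent_sum u (p t)) = (if u = w then 1 else 0)"
    and inverse_qp: "u \<in> V \<Longrightarrow> w \<in> V \<Longrightarrow>
      (\<Sum>t\<in>V. exponent_sum t (p w) * exponent_sum u (q t)) = (if u = w then 1 else 0)"
begin

definition star :: "'a \<Rightarrow> 'a set" where
  "star v = {u \<in> V. u = v \<or> (v, u) \<in> E}"

definition max_star :: "'a set" where
  "max_star = {v \<in> V. \<forall>u\<in>V. card (star u) \<le> card (star v)}"

lemma finite_star: "finite (star v)"
  using finite_V by (simp add: star_def)

lemma star_subset: "star v \<subseteq> V"
  by (auto simp: star_def)

lemma max_starD: "v \<in> max_star \<Longrightarrow> v \<in> V"
  by (simp add: max_star_def)

lemma max_starI: "v \<in> max_star \<Longrightarrow> u \<in> V \<Longrightarrow> card (star v) \<le> card (star u) \<Longrightarrow> u \<in> max_star"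
  unfolding max_star_def using le_trans by blast

lemma finite_max_star: "finite max_star"
  using finite_V by (simp add: max_star_def)

text \<open>The inverse recovers the coefficients of a combination of images in the abelianization.\<close>

lemma coefficients_from_image:
  assumes "t \<in> V"
  shows "c t = (\<Sum>s\<in>V. (\<Sum>w\<in>V. c w * exponent_sum s (p w)) * exponent_sum t (q s))"
proof -
  have "c t = (\<Sum>w\<in>V. if w = t then c w else 0)"
    using assms finite_V by simp
  also have "\<dots> = (\<Sum>w\<in>V. c w * (if t = w then 1 else 0))"
    by (rule sum.cong) auto
  also have "\<dots> = (\<Sum>w\<in>V. c w * (\<Sum>s\<in>V. exponent_sum s (p w) * exponent_sum t (q s)))"
    by (rule sum.cong) (use inverse_qp assms in auto)
  also have "\<dots> = (\<Sum>w\<in>V. \<Sum>s\<in>V. c w * exponent_sum s (p w) * exponent_sum t (q s))"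
    by (simp add: sum_distrib_left mult.assoc)
  also have "\<dots> = (\<Sum>s\<in>V. \<Sum>w\<in>V. c w * exponent_sum s (p w) * exponent_sum t (q s))"
    by (rule sum.swap)
  finally show ?thesis by (simp add: sum_distrib_right)
qed

lemma sum_star_extend:
  "(\<Sum>w\<in>star v. c w * f w) = (\<Sum>w\<in>V. (if w \<in> star v then c w else 0) * f w)" for c f :: "'a \<Rightarrow> int"
  by (rule sum.mono_neutral_cong_left) (use finite_V star_subset in auto)

lemma magnus_commute:
  assumes "v \<in> V" "w \<in> star v"
  shows "magnus E d (p v) * magnus E d (p w) = magnus E d (p w) * magnus E d (p v)"
proof (cases "w = v")
  case False
  then have "(p v @ p w, p w @ p v) \<in> raag_rel E V"
    using assms commute_p by (auto simp: star_def)
  from magnus_cong[OF this sym_E irrefl_E] show ?thesis by simp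
qed simp

text \<open>The degree two part of the Magnus expansion of a commutator relation.\<close>

lemma exponent_sums_of_commuting:
  assumes "v \<in> V" "w \<in> star v" "a \<in> V" "b \<in> V" "(a, b) \<notin> E"
  shows "exponent_sum a (p v) * exponent_sum b (p w) = exponent_sum b (p v) * exponent_sum a (p w)"
proof (cases "a = b")
  case False
  have wV: "w \<in> V" using assms(2) star_subset by auto
  let ?x = "\<lambda>u. exponent_sum u (p v)" and ?y = "\<lambda>u. exponent_sum u (p w)"
  let ?f = "magnus E unit_weight (p v)" and ?g = "magnus E unit_weight (p w)"
  have "(?f * ?g) $ 2 = (?g * ?f) $ 2"
    using magnus_commute[OF assms(1,2)] by simp
  then have "?f $ 1 * ?g $ 1 = ?g $ 1 * ?f $ 1"
    by (simp add: fps_mult_nth numeral_2_eq_2 add.commute)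
  then have "linear_form E V ?x * linear_form E V ?y = linear_form E V ?y * linear_form E V ?x"
    using magnus_nth_1[OF finite_V words_p, of v E] magnus_nth_1[OF finite_V words_p, of w E]
      assms(1) wV by simp
  then have "?x a * ?y b = ?y a * ?x b"
    using lookup_linear_form_times[OF finite_V assms(3,4) False assms(5)] by metis
  then show ?thesis by simp
qed simp

text \<open>
  Let \<open>v\<close> have maximal degree and let \<open>s\<close> occur in the image of \<open>v\<close> in the abelianization. The
  images of the vertices in \<open>star v\<close> are linearly independent and satisfy the bilinear relations
  with the image of \<open>v\<close>, by which each of them is determined by its restriction to \<open>star s\<close>. So
  \<open>star s\<close> is at least as large as \<open>star v\<close>, and since the sizes agree, the combinations of these
  images contain a multiple of every neighbour of \<open>s\<close>.
\<close>

lemma star_combination_eq_0: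
  assumes "v \<in> V" "s \<in> V" "exponent_sum s (p v) \<noteq> 0"
    and "(\<Sum>w\<in>star v. c w * exponent_sum s (p w)) = 0" "u \<in> V" "u \<notin> star s"
  shows "(\<Sum>w\<in>star v. c w * exponent_sum u (p w)) = 0"
proof -
  have nadj: "(s, u) \<notin> E" using assms by (auto simp: star_def)
  have "exponent_sum s (p v) * (\<Sum>w\<in>star v. c w * exponent_sum u (p w)) =
      (\<Sum>w\<in>star v. c w * (exponent_sum s (p v) * exponent_sum u (p w)))"
    by (simp add: sum_distrib_left mult.left_commute)
  also have "\<dots> = (\<Sum>w\<in>star v. c w * (exponent_sum u (p v) * exponent_sum s (p w)))"
    using exponent_sums_of_commuting[OF assms(1) _ assms(2,5) nadj] by simp
  also have "\<dots> = exponent_sum u (p v) * (\<Sum>w\<in>star v. c w * exponent_sum s (p w))"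
    by (simp add: sum_distrib_left mult.left_commute)
  finally show ?thesis using assms by simp
qed

lemma star_combination_nonzero:
  assumes "\<exists>w\<in>star v. c w \<noteq> 0"
  shows "\<exists>u\<in>V. (\<Sum>w\<in>star v. c w * exponent_sum u (p w)) \<noteq> 0"
proof (rule ccontr)
  assume *: "\<not> ?thesis"
  obtain w where "w \<in> star v" "c w \<noteq> 0" using assms by blast
  then show False
    using coefficients_from_image[of w "\<lambda>w. if w \<in> star v then c w else 0"] * star_subset
    by (auto simp: sum_star_extend)
qed

lemma support_in_max_star:
  assumes "v \<in> max_star" "s \<in> V" "exponent_sum s (p v) \<noteq> 0"
  shows "s \<in> max_star"
proof (rule ccontr)
  assume "s \<notin> max_star"
  then have "card (star s) < card (star v)"
    using max_starI[OF assms(1,2)] by linarith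
  then obtain c where c: "\<exists>w\<in>star v. c w \<noteq> 0"
      "\<forall>u\<in>star s. (\<Sum>w\<in>star v. c w * exponent_sum u (p w)) = 0"
    using homogeneous_system_nontrivial_solution[OF finite_star finite_star, of s v "\<lambda>w u. exponent_sum u (p w)"]
    by blast
  have "s \<in> star s" using assms(2) by (simp add: star_def)
  then have "\<forall>u\<in>V. (\<Sum>w\<in>star v. c w * exponent_sum u (p w)) = 0"
    using c(2) star_combination_eq_0[OF max_starD[OF assms(1)] assms(2,3)] by blast
  then show False using star_combination_nonzero[OF c(1)] by blast
qed

lemma neighbour_combination:
  assumes "v \<in> max_star" "s \<in> V" "exponent_sum s (p v) \<noteq> 0" "l \<in> star s" "l \<noteq> s"
  obtains c N where "N \<noteq> 0"
    "\<And>u. u \<in> V \<Longrightarrow> (\<Sum>w\<in>star v. c w * exponent_sum u (p w)) = (if u = l then N else 0)"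
proof -
  have "card (star s) \<le> card (star v)"
    using assms(1,2) by (simp add: max_star_def)
  then have "card (star s - {l}) < card (star v)"
    using assms(4) finite_star[of s] by (metis card_Diff1_less less_le_trans)
  then obtain c where c: "\<exists>w\<in>star v. c w \<noteq> 0"
      "\<forall>u\<in>star s - {l}. (\<Sum>w\<in>star v. c w * exponent_sum u (p w)) = 0"
    using homogeneous_system_nontrivial_solution[OF _ finite_star,
        of "star s - {l}" v "\<lambda>w u. exponent_sum u (p w)"] finite_star[of s] by auto
  have "s \<in> star s - {l}" using assms(2,5) by (simp add: star_def)
  then have zero: "(\<Sum>w\<in>star v. c w * exponent_sum u (p w)) = 0" if "u \<in> V" "u \<noteq> l" for u
    using c(2) star_combination_eq_0[OF max_starD[OF assms(1)] assms(2,3)] that by blast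
  then have "(\<Sum>w\<in>star v. c w * exponent_sum l (p w)) \<noteq> 0"
    using star_combination_nonzero[OF c(1)] by metis
  then show thesis using that[of "\<Sum>w\<in>star v. c w * exponent_sum l (p w)" c] zero by auto
qed

lemma image_nonzero:
  assumes "v \<in> V"
  obtains s where "s \<in> V" "exponent_sum s (p v) \<noteq> 0"
proof -
  have "(\<Sum>w\<in>star v. (if w = v then 1 else 0) * exponent_sum u (p w)) = exponent_sum u (p v)" for u
    using assms finite_star[of v]
    by (simp add: if_distrib[of "\<lambda>x. x * _"] sum.delta star_def cong: if_cong)
  moreover have "\<exists>w\<in>star v. (if w = v then 1 else 0 :: int) \<noteq> 0"
    using assms by (intro bexI[of _ v]) (auto simp: star_def)
  ultimately show thesis
    using star_combination_nonzero[of v "\<lambda>w. if w = v then 1 else 0"] that by auto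
qed

text \<open>
  A multiple of \<open>u\<close> is a combination of elements that commute with the image of \<open>v\<close> in the
  quotient of class two, so \<open>u\<close> commutes with every vertex in the support of that image.
\<close>

lemma support_common_neighbours:
  assumes "v \<in> max_star" "s \<in> V" "exponent_sum s (p v) \<noteq> 0"
    and "l \<in> V" "exponent_sum l (p v) \<noteq> 0" "u \<in> star s" "u \<notin> max_star"
  shows "(u, l) \<in> E"
proof (rule ccontr)
  assume "(u, l) \<notin> E"
  then have nadj: "(l, u) \<notin> E" using sym_E by (auto dest: symD)
  have us: "u \<noteq> s" "u \<noteq> l" "u \<in> V"
    using support_in_max_star[OF assms(1)] assms star_subset by auto
  obtain c N where N: "N \<noteq> 0"
      "\<And>t. t \<in> V \<Longrightarrow> (\<Sum>w\<in>star v. c w * exponent_sum t (p w)) = (if t = u then N else 0)"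
    using neighbour_combination[OF assms(1-3,6) us(1)] by blast
  have "exponent_sum l (p v) * N = exponent_sum l (p v) * (\<Sum>w\<in>star v. c w * exponent_sum u (p w))"
    using N(2)[OF us(3)] by simp
  also have "\<dots> = (\<Sum>w\<in>star v. c w * (exponent_sum l (p v) * exponent_sum u (p w)))"
    by (simp add: sum_distrib_left mult.left_commute)
  also have "\<dots> = (\<Sum>w\<in>star v. c w * (exponent_sum u (p v) * exponent_sum l (p w)))"
    using exponent_sums_of_commuting[OF max_starD[OF assms(1)] _ assms(4) us(3) nadj] by simp
  also have "\<dots> = exponent_sum u (p v) * (\<Sum>w\<in>star v. c w * exponent_sum l (p w))"
    by (simp add: sum_distrib_left mult.left_commute)
  finally show False using N(1) N(2)[OF assms(4)] us(2) assms(5) by simp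
qed

end

lemma (in inverse_substitutions) swap: "inverse_substitutions E V q p"
  by unfold_locales
    (use sym_E irrefl_E finite_V words_p words_q commute_p commute_q inverse_pq inverse_qp in auto)

context inverse_substitutions
begin

text \<open>
  The inverse automorphism also preserves the span of \<open>max_star\<close> in the abelianization, so a
  combination of images that lies in this span only involves vertices of \<open>max_star\<close>.
\<close>

lemma combination_in_max_star:
  assumes "l \<in> max_star" "w \<in> star v" "w \<notin> max_star"
    and "\<And>u. u \<in> V \<Longrightarrow> (\<Sum>w\<in>star v. c w * exponent_sum u (p w)) = (if u = l then N else 0)"
  shows "c w = 0"
proof -
  interpret swapped: inverse_substitutions E V q p by (rule swap)
  have w: "w \<in> V" using assms(2) star_subset by auto
  have "exponent_sum w (q l) = 0"
    using swapped.support_in_max_star[OF assms(1) w] assms(3) by auto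
  moreover have "c w = (\<Sum>s\<in>V. (if s = l then N else 0) * exponent_sum w (q s))"
    using coefficients_from_image[OF w, of "\<lambda>w. if w \<in> star v then c w else 0"] assms(2,4)
    by (simp add: sum_star_extend)
  ultimately show ?thesis
    using finite_V by (auto intro!: sum.neutral)
qed

text \<open>
  Suppose some vertex of \<open>max_star\<close> is not mapped into the kernel of the retraction that kills
  \<open>max_star\<close>. Among these vertices let \<open>v\<close> be one for which the term \<open>z\<close> of lowest positive degree
  \<open>k\<close> in the Magnus expansion of the retracted image has the least degree. Give the letters of
  \<open>max_star\<close> weight \<open>k\<close> and the other letters weight \<open>1\<close>: then the image of \<open>v\<close> has leading term
  \<open>x + z\<close>, where \<open>x\<close> is its linear part. It commutes with the leading terms of the images of all
  vertices of \<open>star v\<close>. Let \<open>s\<close> be a vertex in the support of \<open>x\<close> and \<open>l\<close> a neighbour of \<open>s\<close>. A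
  combination of these leading terms is \<open>N l\<close>, or \<open>N l + z'\<close> with \<open>z'\<close> in the letters outside
  \<open>max_star\<close> if \<open>l\<close> is in \<open>max_star\<close>. Comparing coefficients in its commutation with \<open>x + z\<close> shows
  that each letter \<open>t\<close> of \<open>z\<close> is equal to \<open>l\<close> or commutes with \<open>l\<close>. This makes \<open>star t\<close> as large
  as \<open>star s\<close>, although \<open>t\<close> is not in \<open>max_star\<close>.
\<close>

theorem image_of_max_star_vanishes:
  assumes "v \<in> max_star"
  shows "(filter (\<lambda>x. fst x \<notin> max_star) (p v), []) \<in> raag_rel E (V - max_star)"
proof (rule ccontr)
  assume neg: "\<not> ?thesis"
  let ?C = max_star and ?W = "V - max_star"
  define r :: "'a word \<Rightarrow> 'a word" where "r = filter (\<lambda>x. fst x \<notin> ?C)"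
  define M where "M w = magnus E unit_weight (r (p w))" for w
  have r_words: "r (p w) \<in> words ?W" if "w \<in> V" for w
    using words_p[OF that] by (auto simp: r_def words_def)
  have "M v \<noteq> 1"
    using magnus_faithful[OF sym_E irrefl_E r_words[OF max_starD[OF assms]]] neg
    by (auto simp: M_def r_def)
  then obtain k0 where "M v $ k0 \<noteq> 1 $ k0" by (auto simp: fps_eq_iff)
  moreover from this have "k0 \<noteq> 0" by (intro notI) (simp add: M_def)
  ultimately have ex: "\<exists>k. k > 0 \<and> (\<exists>v\<in>?C. M v $ k \<noteq> 0)" using assms by auto
  define k where "k = (LEAST k. k > 0 \<and> (\<exists>v\<in>?C. M v $ k \<noteq> 0))"
  have "k > 0 \<and> (\<exists>v\<in>?C. M v $ k \<noteq> 0)" unfolding k_def by (rule LeastI_ex[OF ex])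
  then obtain v where v: "v \<in> ?C" "M v $ k \<noteq> 0" and k: "k > 0" by blast
  have low: "M w $ j = 0" if "w \<in> ?C" "0 < j" "j < k" for w j
    using not_less_Least[of j "\<lambda>k. k > 0 \<and> (\<exists>v\<in>?C. M v $ k \<noteq> 0)"] that by (auto simp: k_def)
  have vV: "v \<in> V" by (rule max_starD[OF v(1)])
  let ?x = "\<lambda>w u. exponent_sum u (p w)"
  define d where "d s = (if s \<in> ?C then k else 1)" for s
  define G where "G w = magnus E d (p w)" for w
  have G: "\<forall>j<k. G w $ j = M w $ j" "G w $ k = M w $ k + linear_form E ?C (?x w)" for w
    using magnus_weighted_low_terms[OF finite_max_star, of k E "p w"] k
    by (simp_all add: G_def M_def r_def d_def [abs_def])
  have G_low: "G w $ j = 0" if "w \<in> ?C" "0 < j" "j < k" for w j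
    using G(1) low that by simp
  have M1: "M w $ 1 = linear_form E ?W (?x w)" if "w \<in> V" for w
    using magnus_nth_1[OF _ r_words[OF that], of E] finite_V
    by (auto simp: M_def r_def exponent_sum_filter intro: linear_form_cong)
  \<comment> \<open>The linear part of the image of \<open>v\<close> lives on \<open>max_star\<close>, so the retraction kills it.\<close>
  have "M v $ 1 = 0"
  proof -
    have "linear_form E ?W (?x v) = linear_form E ?W (\<lambda>_. 0)"
      using support_in_max_star[OF v(1)] by (intro linear_form_cong) auto
    then show ?thesis using M1[OF vV] by simp
  qed
  then have k1: "k > 1" using v(2) k by (cases "k = 1") auto
  define z where "z w = M w $ k" for w
  define A where "A w = z w + linear_form E ?C (?x w)" for w
  have keys_z: "keys (z w) \<subseteq> trace_of E ` lists ?W" if "w \<in> V" for w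
    using keys_magnus_nth[OF r_words[OF that], of E k]
    by (auto simp: z_def M_def homogeneous_traces_def lists_eq_set)
  have comm_C: "A v * A w = A w * A v" if "w \<in> star v" "w \<in> ?C" for w
    using leading_coefficients_commute[OF magnus_commute[OF vV that(1), of d], of k k] k
      G_low[OF v(1)] G_low[OF that(2)] G(2)
    by (simp add: A_def z_def G_def)
  have comm_W: "A v * linear_form E ?W (?x w) = linear_form E ?W (?x w) * A v"
    if "w \<in> star v" "w \<notin> ?C" for w
  proof -
    have "G w $ 1 = linear_form E ?W (?x w)" using G(1) k1 M1 that(1) star_subset[of v] by auto
    then show ?thesis
      using leading_coefficients_commute[OF magnus_commute[OF vV that(1), of d], of k 1] k
        G_low[OF v(1)] G(2)
      by (simp add: A_def z_def G_def)
  qed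
  obtain s where s: "s \<in> V" "?x v s \<noteq> 0" using image_nonzero[OF vV] .
  have sC: "s \<in> ?C" using support_in_max_star[OF v(1) s] .
  obtain K where "K \<in> keys (z v)" using v(2) by (metis all_not_in_conv keys_eq_empty z_def)
  then obtain m where m: "m \<in> lists ?W" "trace_of E m \<in> keys (z v)"
    using keys_z[OF vV] by blast
  have "m \<noteq> []"
  proof
    assume "m = []"
    moreover obtain u where "trace_of E m = trace_of E u" "length u = k"
      using m(2) keys_magnus_nth[OF r_words[OF vV], of E k]
      by (auto simp: z_def M_def homogeneous_traces_def)
    ultimately show False using set_trace_of_eq[OF _ irrefl_E, of m u] k by auto
  qed
  then obtain t where t: "t \<in> set m" by (cases m) auto
  then have tW: "t \<in> V" "t \<notin> ?C" using m(1) by (auto dest: in_listsD)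
  have key: "t = l \<or> (t, l) \<in> E" if l: "l \<in> star s" "l \<noteq> s" for l
  proof (rule ccontr)
    assume "\<not> (t = l \<or> (t, l) \<in> E)"
    then have tl: "t \<noteq> l" "(t, l) \<notin> E" by auto
    have lV: "l \<in> V" using l star_subset by auto
    obtain c N where N: "N \<noteq> 0"
      "\<And>u. u \<in> V \<Longrightarrow> (\<Sum>w\<in>star v. c w * ?x w u) = (if u = l then N else 0)"
      using neighbour_combination[OF v(1) s l] by blast
    show False
    proof (cases "l \<in> ?C")
      case False
      \<comment> \<open>Outside \<open>max_star\<close> only the images of vertices outside \<open>max_star\<close> contribute, so \<open>x + z\<close>
        commutes with \<open>N l\<close>.\<close>
      let ?S = "star v - ?C"
      have "linear_form E ?W (\<lambda>u. \<Sum>w\<in>?S. c w * ?x w u) = linear_form E ?W (\<lambda>u. if u = l then N else 0)"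
      proof (rule linear_form_cong)
        fix u assume u: "u \<in> ?W"
        have "(\<Sum>w\<in>?S. c w * ?x w u) = (\<Sum>w\<in>star v. c w * ?x w u)"
          using support_in_max_star u by (intro sum.mono_neutral_left) (use finite_star in auto)
        then show "(\<Sum>w\<in>?S. c w * ?x w u) = (if u = l then N else 0)" using N(2) u by simp
      qed
      also have "\<dots> = Poly_Mapping.single (trace_letter E l) N"
        using linear_form_delta[of ?W E l N] finite_V False lV by simp
      finally have eq: "Poly_Mapping.single (trace_letter E l) N =
          (\<Sum>w\<in>?S. of_int (c w) * linear_form E ?W (?x w))"
        by (simp add: linear_form_combination)
      have "A v * Poly_Mapping.single (trace_letter E l) N = Poly_Mapping.single (trace_letter E l) N * A v"
        unfolding eq by (rule integer_combination_commutes) (use comm_W in blast)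
      then show False
        using letters_commute_with_centralized_letter[OF irrefl_E, of ?C ?W l N "z v" "?x v" m t]
          keys_z[OF vV] m t False lV N(1) tl by (auto simp: A_def)
    next
      case True
      \<comment> \<open>The combination only involves vertices of \<open>max_star\<close>, whose images start in weight \<open>k\<close>, so
        \<open>x + z\<close> commutes with \<open>z' + N l\<close>.\<close>
      let ?S = "star v \<inter> ?C"
      define z' where "z' = (\<Sum>w\<in>?S. of_int (c w) * z w)"
      define y where "y u = (if u = l then N else 0)" for u
      have c0: "c w = 0" if "w \<in> star v" "w \<notin> ?C" for w
        using combination_in_max_star[OF True that N(2)] .
      have "linear_form E ?C (\<lambda>u. \<Sum>w\<in>?S. c w * ?x w u) = linear_form E ?C y"
      proof (rule linear_form_cong)
        fix u assume u: "u \<in> ?C"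
        have "(\<Sum>w\<in>?S. c w * ?x w u) = (\<Sum>w\<in>star v. c w * ?x w u)"
          by (intro sum.mono_neutral_left) (use finite_star c0 in auto)
        then show "(\<Sum>w\<in>?S. c w * ?x w u) = y u" using N(2) max_starD[OF u] by (simp add: y_def)
      qed
      then have eq: "z' + linear_form E ?C y = (\<Sum>w\<in>?S. of_int (c w) * A w)"
        unfolding A_def z'_def distrib_left sum.distrib by (simp add: linear_form_combination)
      have comm: "A v * (z' + linear_form E ?C y) = (z' + linear_form E ?C y) * A v"
        unfolding eq by (rule integer_combination_commutes) (use comm_C in blast)
      have "keys (of_int (c w) * z w) \<subseteq> trace_of E ` lists ?W" if "w \<in> ?S" for w
      proof -
        have "of_int (c w) * z w = Poly_Mapping.single 0 (c w) * z w" by (simp flip: single_of_int)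
        then show ?thesis
          using keys_mult[of "Poly_Mapping.single 0 (c w)" "z w"] keys_z[of w] that star_subset
          by (fastforce split: if_splits)
      qed
      then have kz': "keys z' \<subseteq> trace_of E ` lists ?W"
        unfolding z'_def using keys_sum[of "\<lambda>w. of_int (c w) * z w" ?S] by blast
      have coeff: "y a * lookup (z v) (trace_of E m) = ?x v a * lookup z' (trace_of E m)"
        if "a \<in> ?C" "b \<in> set m" "(b, a) \<notin> E" for a b
        using commuting_sums_coefficients[OF irrefl_E finite_max_star _ keys_z[OF vV] kz' _ that(1) m(1) that(2,3)]
          comm by (auto simp: A_def)
      have zm: "lookup (z v) (trace_of E m) \<noteq> 0" using m(2) by (simp add: in_keys_iff)
      \<comment> \<open>If \<open>l\<close> is not in the support of \<open>x\<close>, this is already absurd. Otherwise the coefficients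
        at the letter \<open>s\<close> show that \<open>z'\<close> has no such monomial.\<close>
      have l_eq: "N * lookup (z v) (trace_of E m) = ?x v l * lookup z' (trace_of E m)"
        using coeff[OF True t tl(2)] by (simp add: y_def)
      then have xl: "?x v l \<noteq> 0" using N(1) zm by auto
      have "(t, s) \<notin> E"
      proof
        assume "(t, s) \<in> E"
        then have "t \<in> star s" using tW sym_E by (auto simp: star_def dest: symD)
        then show False using support_common_neighbours[OF v(1) s lV xl _ tW(2)] tl by blast
      qed
      from coeff[OF sC t this] have "?x v s * lookup z' (trace_of E m) = 0"
        using l(2) by (simp add: y_def)
      then show False using s(2) l_eq N(1) zm by auto
    qed
  qed
  \<comment> \<open>Either \<open>t\<close> is a neighbour of \<open>s\<close> and commutes with all of \<open>star s\<close>, or it replaces \<open>s\<close> in its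
    star.\<close>
  have "card (star s) \<le> card (star t)"
  proof (cases "t \<in> star s")
    case True
    then have "star s \<subseteq> star t"
      using key sym_E tW sC by (auto simp: star_def dest: symD)
    then show ?thesis using card_mono finite_star by blast
  next
    case False
    have "insert t (star s - {s}) \<subseteq> star t"
      using key tW star_subset by (auto simp: star_def)
    then have "card (insert t (star s - {s})) \<le> card (star t)"
      using card_mono finite_star by blast
    moreover have "s \<in> star s" using s(1) by (simp add: star_def)
    then have "card (insert t (star s - {s})) = card (star s)"
      using False finite_star[of s] card_Suc_Diff1[OF finite_star, of s s]
      by (subst card_insert_disjoint) auto
    ultimately show ?thesis by simp
  qed
  then show False using max_starI[OF sC tW(1)] tW(2) by blast
qed

end

section \<open>Epimorphisms with characteristic kernel\<close>

definition characteristic_epi ::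
    "('c \<Rightarrow> 'e) \<Rightarrow> ('c, 'd) monoid_scheme \<Rightarrow> ('e, 'f) monoid_scheme \<Rightarrow> bool" where
  "characteristic_epi f G H \<longleftrightarrow> f \<in> hom G H \<and> f ` carrier G = carrier H \<and>
    (\<forall>\<phi>\<in>iso G G. \<forall>x\<in>carrier G. f x = \<one>\<^bsub>H\<^esub> \<longrightarrow> f (\<phi> x) = \<one>\<^bsub>H\<^esub>)"

lemma iso_inverse:
  assumes "group G" "\<phi> \<in> iso G G"
  obtains \<psi> where "\<psi> \<in> iso G G" "\<forall>x\<in>carrier G. \<phi> (\<psi> x) = x" "\<forall>x\<in>carrier G. \<psi> (\<phi> x) = x"
proof
  have "bij_betw \<phi> (carrier G) (carrier G)" using assms(2) by (simp add: iso_def)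
  then show "\<forall>x\<in>carrier G. \<phi> (inv_into (carrier G) \<phi> x) = x"
    "\<forall>x\<in>carrier G. inv_into (carrier G) \<phi> (\<phi> x) = x"
    by (simp_all add: bij_betw_inv_into_right bij_betw_inv_into_left)
  show "inv_into (carrier G) \<phi> \<in> iso G G" by (rule group.iso_set_sym[OF assms])
qed

lemma iso_closed: "\<phi> \<in> iso G H \<Longrightarrow> x \<in> carrier G \<Longrightarrow> \<phi> x \<in> carrier H"
  by (auto simp: iso_def hom_def)

lemma iso_mult: "\<phi> \<in> iso G H \<Longrightarrow> x \<in> carrier G \<Longrightarrow> y \<in> carrier G \<Longrightarrow> \<phi> (x \<otimes>\<^bsub>G\<^esub> y) = \<phi> x \<otimes>\<^bsub>H\<^esub> \<phi> y"
  by (auto simp: iso_def hom_def)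

lemma iso_one: "group G \<Longrightarrow> \<phi> \<in> iso G G \<Longrightarrow> \<phi> \<one>\<^bsub>G\<^esub> = \<one>\<^bsub>G\<^esub>"
  by (rule hom_one[OF iso_imp_homomorphism])

lemma characteristic_epi_imp_quotient:
  assumes "group G" "group H" "characteristic_epi f G H"
  shows "characteristic_quotient H G"
proof -
  interpret group_hom G H f
    using assms by (auto simp: group_hom_def group_hom_axioms_def characteristic_epi_def)
  let ?N = "kernel G H f"
  have sub: "\<phi> ` ?N \<subseteq> ?N" if "\<phi> \<in> iso G G" for \<phi>
    using assms(3) that iso_closed[OF that] by (auto simp: characteristic_epi_def kernel_def)
  have "\<phi> ` ?N = ?N" if \<phi>: "\<phi> \<in> iso G G" for \<phi>
  proof
    obtain \<psi> where \<psi>: "\<psi> \<in> iso G G" "\<And>x. x \<in> carrier G \<Longrightarrow> \<phi> (\<psi> x) = x"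
        "\<And>x. x \<in> carrier G \<Longrightarrow> \<psi> (\<phi> x) = x"
      using iso_inverse[OF assms(1) \<phi>] by metis
    show "?N \<subseteq> \<phi> ` ?N"
    proof
      fix x assume "x \<in> ?N"
      then have "\<psi> x \<in> ?N" "\<phi> (\<psi> x) = x" using sub[OF \<psi>(1)] \<psi>(2) by (auto simp: kernel_def)
      then show "x \<in> \<phi> ` ?N" by (metis imageI)
    qed
  qed (rule sub[OF \<phi>])
  then have "characteristic_subgroup ?N G"
    using subgroup_kernel by (simp add: characteristic_subgroup_def)
  moreover have "G Mod ?N \<cong> H"
    using FactGroup_iso assms(3) by (simp add: characteristic_epi_def)
  then have "H \<cong> G Mod ?N"
    using group.iso_sym[OF normal.factorgroup_is_group[OF normal_kernel]] by blast
  ultimately show ?thesis unfolding characteristic_quotient_def by blast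
qed

text \<open>
  The image of \<open>f x\<close> is well defined because the automorphism preserves the kernel, and injective
  because its inverse preserves the kernel as well.
\<close>

lemma characteristic_epi_descends:
  assumes "group G" "group H" "characteristic_epi f G H" "\<phi> \<in> iso G G"
  obtains \<psi> where "\<psi> \<in> iso H H" "\<forall>x\<in>carrier G. \<psi> (f x) = f (\<phi> x)"
proof -
  interpret group_hom G H f
    using assms by (auto simp: group_hom_def group_hom_axioms_def characteristic_epi_def)
  have surj: "f ` carrier G = carrier H" using assms(3) by (simp add: characteristic_epi_def)
  have eq: "f (\<theta> x) = f (\<theta> y)"
    if "\<theta> \<in> iso G G" "x \<in> carrier G" "y \<in> carrier G" "f x = f y" for \<theta> x y
  proof -
    have "f (x \<otimes>\<^bsub>G\<^esub> inv\<^bsub>G\<^esub> y) = \<one>\<^bsub>H\<^esub>" using that by simp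
    then have "f (\<theta> (x \<otimes>\<^bsub>G\<^esub> inv\<^bsub>G\<^esub> y)) = \<one>\<^bsub>H\<^esub>"
      using assms(3) that by (simp add: characteristic_epi_def)
    moreover have "\<theta> (x \<otimes>\<^bsub>G\<^esub> inv\<^bsub>G\<^esub> y) \<otimes>\<^bsub>G\<^esub> \<theta> y = \<theta> x"
      using that iso_mult[OF that(1), of "x \<otimes>\<^bsub>G\<^esub> inv\<^bsub>G\<^esub> y" y] by (simp add: G.m_assoc)
    moreover have "f (\<theta> (x \<otimes>\<^bsub>G\<^esub> inv\<^bsub>G\<^esub> y) \<otimes>\<^bsub>G\<^esub> \<theta> y) = f (\<theta> (x \<otimes>\<^bsub>G\<^esub> inv\<^bsub>G\<^esub> y)) \<otimes>\<^bsub>H\<^esub> f (\<theta> y)"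
      using that iso_closed[OF that(1)] by (intro hom_mult) auto
    ultimately show ?thesis using that iso_closed[OF that(1)] by simp
  qed
  obtain \<phi>' where \<phi>': "\<phi>' \<in> iso G G" "\<And>x. x \<in> carrier G \<Longrightarrow> \<phi> (\<phi>' x) = x" "\<And>x. x \<in> carrier G \<Longrightarrow> \<phi>' (\<phi> x) = x"
    using iso_inverse[OF assms(1,4)] by metis
  define \<psi> where "\<psi> y = f (\<phi> (inv_into (carrier G) f y))" for y
  have \<psi>: "\<psi> (f x) = f (\<phi> x)" if "x \<in> carrier G" for x
    unfolding \<psi>_def using that
    by (intro eq[OF assms(4)]) (auto intro: inv_into_into f_inv_into_f)
  have "\<psi> \<in> hom H H"
  proof (rule homI)
    fix y assume "y \<in> carrier H"
    then obtain x where x: "x \<in> carrier G" "y = f x" using surj by auto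
    then show "\<psi> y \<in> carrier H" using \<psi> iso_closed[OF assms(4)] by simp
    fix y' assume "y' \<in> carrier H"
    then obtain x' where x': "x' \<in> carrier G" "y' = f x'" using surj by auto
    have "y \<otimes>\<^bsub>H\<^esub> y' = f (x \<otimes>\<^bsub>G\<^esub> x')" using x x' by simp
    then have "\<psi> (y \<otimes>\<^bsub>H\<^esub> y') = f (\<phi> (x \<otimes>\<^bsub>G\<^esub> x'))"
      using \<psi>[of "x \<otimes>\<^bsub>G\<^esub> x'"] x x' by simp
    then show "\<psi> (y \<otimes>\<^bsub>H\<^esub> y') = \<psi> y \<otimes>\<^bsub>H\<^esub> \<psi> y'"
      using x x' \<psi> iso_mult[OF assms(4)] iso_closed[OF assms(4)] by simp
  qed
  moreover have "inj_on \<psi> (carrier H)"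
  proof (rule inj_onI)
    fix y y' assume "y \<in> carrier H" "y' \<in> carrier H" "\<psi> y = \<psi> y'"
    moreover from this obtain x where "x \<in> carrier G" "y = f x" using surj by auto
    moreover from \<open>y' \<in> carrier H\<close> obtain x' where "x' \<in> carrier G" "y' = f x'" using surj by auto
    ultimately show "y = y'"
      using eq[OF \<phi>'(1), of "\<phi> x" "\<phi> x'"] \<psi> \<phi>'(3) iso_closed[OF assms(4)] by simp
  qed
  moreover have "\<psi> ` carrier H = carrier H"
  proof
    show "\<psi> ` carrier H \<subseteq> carrier H" using \<open>\<psi> \<in> hom H H\<close> by (auto simp: hom_def)
    show "carrier H \<subseteq> \<psi> ` carrier H"
    proof
      fix y assume "y \<in> carrier H"
      then obtain x where x: "x \<in> carrier G" "y = f x" using surj by auto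
      then have "y = \<psi> (f (\<phi>' x))" "f (\<phi>' x) \<in> carrier H"
        using \<psi> \<phi>'(2) iso_closed[OF \<phi>'(1)] by auto
      then show "y \<in> \<psi> ` carrier H" by blast
    qed
  qed
  ultimately have "\<psi> \<in> iso H H" by (simp add: Group.iso_iff)
  then show thesis using that \<psi> by blast
qed

lemma characteristic_epi_comp:
  assumes "group G" "group H" "characteristic_epi f G H" "characteristic_epi h H K"
  shows "characteristic_epi (h \<circ> f) G K"
  unfolding characteristic_epi_def
proof (intro conjI ballI impI)
  show "h \<circ> f \<in> hom G K"
    using assms(3,4) by (auto simp: characteristic_epi_def intro: hom_compose)
  show "(h \<circ> f) ` carrier G = carrier K"
    using assms(3,4) unfolding image_comp [symmetric] by (simp add: characteristic_epi_def)
  fix \<phi> x assume \<phi>: "\<phi> \<in> iso G G" and x: "x \<in> carrier G" "(h \<circ> f) x = \<one>\<^bsub>K\<^esub>"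
  obtain \<psi> where \<psi>: "\<psi> \<in> iso H H" "\<And>x. x \<in> carrier G \<Longrightarrow> \<psi> (f x) = f (\<phi> x)"
    using characteristic_epi_descends[OF assms(1-3) \<phi>] by metis
  have "f x \<in> carrier H" using x(1) assms(3) by (auto simp: characteristic_epi_def)
  then have "h (\<psi> (f x)) = \<one>\<^bsub>K\<^esub>"
    using assms(4) \<psi>(1) x by (auto simp: characteristic_epi_def)
  then show "(h \<circ> f) (\<phi> x) = \<one>\<^bsub>K\<^esub>" using \<psi>(2) x by simp
qed

lemma iso_imp_characteristic_epi:
  assumes "group G" "group H" "f \<in> iso G H"
  shows "characteristic_epi f G H"
  unfolding characteristic_epi_def
proof (intro conjI ballI impI)
  interpret group_hom G H f
    using assms by (auto simp: group_hom_def group_hom_axioms_def iso_def)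
  show "f \<in> hom G H" "f ` carrier G = carrier H" using assms(3) by (auto simp: Group.iso_iff)
  fix \<phi> x assume \<phi>: "\<phi> \<in> iso G G" and x: "x \<in> carrier G" "f x = \<one>\<^bsub>H\<^esub>"
  have "x = \<one>\<^bsub>G\<^esub>" using assms(3) x inj_onD[of f "carrier G" x "\<one>\<^bsub>G\<^esub>"] by (simp add: Group.iso_iff)
  then show "f (\<phi> x) = \<one>\<^bsub>H\<^esub>" using iso_one[OF assms(1) \<phi>] by simp
qed

section \<open>Killing the vertices of maximal degree\<close>

definition induced_map ::
    "('a word \<Rightarrow> 'b word) \<Rightarrow> 'b set \<Rightarrow> 'b word set \<Rightarrow> 'a word set \<Rightarrow> 'b word set" where
  "induced_map h S' R' A = pres_rel S' R' `` {h (SOME w. w \<in> A)}"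

lemma induced_map_class:
  assumes "w \<in> words S"
    and "\<And>u v. (u, v) \<in> pres_rel S R \<Longrightarrow> (h u, h v) \<in> pres_rel S' R'"
  shows "induced_map h S' R' (pres_rel S R `` {w}) = pres_rel S' R' `` {h w}"
  unfolding induced_map_def
  by (rule equiv_class_eq[OF equiv_pres_rel, symmetric], rule assms(2), rule pres_rel_some, rule assms(1))

lemma induced_map_hom:
  assumes "\<And>u v. (u, v) \<in> pres_rel S R \<Longrightarrow> (h u, h v) \<in> pres_rel S' R'"
    and "\<And>u v. h (u @ v) = h u @ h v"
  shows "induced_map h S' R' \<in> hom (presented_group S R) (presented_group S' R')"
proof -
  have h: "h w \<in> words S'" if "w \<in> words S" for w
    using pres_rel_in_words[OF assms(1)[OF pres_rel.refl[OF that]]] by simp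
  have cl: "induced_map h S' R' (pres_rel S R `` {w}) = pres_rel S' R' `` {h w}"
    if "w \<in> words S" for w
    by (rule induced_map_class) (use that assms(1) in auto)
  show ?thesis
    by (rule homI) (auto simp: carrier_presented_group mult_presented_group cl h assms(2))
qed

definition kill_letters :: "'a set \<Rightarrow> 'a word \<Rightarrow> 'a word" where
  "kill_letters C = filter (\<lambda>x. fst x \<notin> C)"

lemma kill_letters_words: "w \<in> words V \<Longrightarrow> kill_letters C w \<in> words (V - C)"
  by (auto simp: kill_letters_def words_def)

lemma kill_letters_cong:
  assumes "(u, v) \<in> raag_rel E V"
  shows "(kill_letters C u, kill_letters C v) \<in> raag_rel E (V - C)"
  using assms
proof (induction rule: pres_rel.induct)
  case (refl w)
  then show ?case by (intro pres_rel.refl kill_letters_words)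
next
  case (sym v w)
  then show ?case by (blast intro: pres_rel.sym)
next
  case (trans u v w)
  then show ?case by (blast intro: pres_rel.trans)
next
  case (cancel u v s b)
  have "kill_letters C u \<in> words (V - C)" "kill_letters C v \<in> words (V - C)"
    using cancel kill_letters_words by blast+
  then show ?case
    using pres_rel.cancel[of "kill_letters C u" "V - C" "kill_letters C v" s b] cancel
      pres_rel.refl[of "kill_letters C u @ kill_letters C v" "V - C"]
    by (auto simp: kill_letters_def)
next
  case (relator u v r)
  let ?u = "kill_letters C u" and ?v = "kill_letters C v"
  have uv: "?u \<in> words (V - C)" "?v \<in> words (V - C)"
    using relator kill_letters_words by blast+
  obtain a b where ab: "r = commutator_word a b" "(a, b) \<in> E" using relator by auto
  then have V: "a \<in> V" "b \<in> V" using relator by (auto simp: commutator_word_def)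
  consider "a \<notin> C" "b \<notin> C" | "a \<in> C" "b \<notin> C" | "a \<notin> C" "b \<in> C" | "a \<in> C" "b \<in> C" by blast
  then have "(?u @ kill_letters C r @ ?v, ?u @ ?v) \<in> raag_rel E (V - C)"
  proof cases
    case 1
    then have r: "kill_letters C r = r" "r \<in> words (V - C)"
      using ab V by (auto simp: kill_letters_def commutator_word_def)
    show ?thesis
      unfolding r(1) by (rule pres_rel.relator[OF uv]) (use r(2) ab in auto)
  next
    case 2
    then have "kill_letters C r = [(b, True), (b, \<not> True)]"
      using ab by (auto simp: kill_letters_def commutator_word_def)
    then show ?thesis using pres_rel.cancel[OF uv, of b True] V 2 by simp
  next
    case 3
    then have "kill_letters C r = [(a, True), (a, \<not> True)]"
      using ab by (auto simp: kill_letters_def commutator_word_def)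
    then show ?thesis using pres_rel.cancel[OF uv, of a True] V 3 by simp
  next
    case 4
    then have "kill_letters C r = []"
      using ab by (auto simp: kill_letters_def commutator_word_def)
    then show ?thesis using uv by (auto intro: pres_rel.refl)
  qed
  then show ?case by (simp add: kill_letters_def)
qed

definition rename_letters :: "('a \<Rightarrow> 'b) \<Rightarrow> 'a word \<Rightarrow> 'b word" where
  "rename_letters g = map (\<lambda>(s, b). (g s, b))"

lemma rename_letters_words: "w \<in> words V \<Longrightarrow> g ` V \<subseteq> V' \<Longrightarrow> rename_letters g w \<in> words V'"
  by (induction w) (auto simp: rename_letters_def)

lemma rename_letters_cong:
  assumes "(u, v) \<in> raag_rel E V" "g ` V \<subseteq> V'"
    and "\<And>a b. a \<in> V \<Longrightarrow> b \<in> V \<Longrightarrow> (a, b) \<in> E \<Longrightarrow> (g a, g b) \<in> E'"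
  shows "(rename_letters g u, rename_letters g v) \<in> raag_rel E' V'"
  using assms(1)
proof (induction rule: pres_rel.induct)
  case (refl w)
  then show ?case using assms(2) by (intro pres_rel.refl rename_letters_words)
next
  case (sym v w)
  then show ?case by (blast intro: pres_rel.sym)
next
  case (trans u v w)
  then show ?case by (blast intro: pres_rel.trans)
next
  case (cancel u v s b)
  have "rename_letters g u \<in> words V'" "rename_letters g v \<in> words V'"
    using cancel rename_letters_words assms(2) by blast+
  then show ?case
    using pres_rel.cancel[of "rename_letters g u" V' "rename_letters g v" "g s" b] cancel assms(2)
    by (auto simp: rename_letters_def)
next
  case (relator u v r)
  obtain a b where ab: "r = commutator_word a b" "(a, b) \<in> E" using relator by auto
  then have V: "a \<in> V" "b \<in> V" using relator by (auto simp: commutator_word_def)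
  have "rename_letters g r = commutator_word (g a) (g b)"
    using ab by (simp add: rename_letters_def commutator_word_def)
  moreover have "rename_letters g u \<in> words V'" "rename_letters g v \<in> words V'"
      "rename_letters g r \<in> words V'"
    using relator rename_letters_words assms(2) by blast+
  ultimately have "(rename_letters g u @ rename_letters g r @ rename_letters g v,
      rename_letters g u @ rename_letters g v) \<in> raag_rel E' V'"
    using assms(3)[OF V ab(2)] by (intro pres_rel.relator) auto
  then show ?case by (simp add: rename_letters_def)
qed

lemma rename_letters_ident:
  "w \<in> words V \<Longrightarrow> (\<And>v. v \<in> V \<Longrightarrow> g (f v) = v) \<Longrightarrow> rename_letters g (rename_letters f w) = w"
  by (induction w) (auto simp: rename_letters_def)

lemma Raag_cong:
  fixes E E' :: "('a \<times> 'a) set"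
  assumes "E \<inter> (V \<times> V) = E' \<inter> (V \<times> V)"
  shows "Raag E V = Raag E' V"
proof -
  have id: "rename_letters id w = w" for w :: "'a word" by (auto simp: rename_letters_def)
  have "raag_rel E V \<subseteq> raag_rel E' V" if "E \<inter> (V \<times> V) = E' \<inter> (V \<times> V)" for E E' :: "('a \<times> 'a) set"
    using rename_letters_cong[where g = id and V = V and E = E and V' = V and E' = E'] that
    by (auto simp: id)
  then have "raag_rel E V = raag_rel E' V" using assms by blast
  then show ?thesis by (simp add: presented_group_def)
qed

lemma Raag_relabel:
  assumes "inj_on f V" "E \<subseteq> V \<times> V"
  shows "\<exists>h. h \<in> iso (Raag E V) (Raag (map_prod f f ` E) (f ` V))"
proof -
  let ?E' = "map_prod f f ` E" and ?V' = "f ` V"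
  define g where "g = inv_into V f"
  have g: "g (f v) = v" if "v \<in> V" for v using that assms(1) by (simp add: g_def)
  have f': "f (g v) = v" if "v \<in> ?V'" for v using that g by auto
  have cf: "(rename_letters f u, rename_letters f v) \<in> raag_rel ?E' ?V'" if "(u, v) \<in> raag_rel E V" for u v
    by (rule rename_letters_cong[OF that]) auto
  have cg: "(rename_letters g u, rename_letters g v) \<in> raag_rel E V" if "(u, v) \<in> raag_rel ?E' ?V'" for u v
    by (rule rename_letters_cong[OF that]) (use g assms(2) in auto)
  let ?h = "\<lambda>f E V. induced_map (rename_letters f) V {commutator_word v w | v w. (v, w) \<in> E}"
  have gV: "g ` ?V' \<subseteq> V" by (auto simp: g_def intro: inv_into_into)
  have words: "rename_letters f w \<in> words ?V'" if "w \<in> words V" for w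
    using rename_letters_words[OF that] by auto
  have words': "rename_letters g w \<in> words V" if "w \<in> words ?V'" for w
    using rename_letters_words[OF that gV] .
  have hf: "?h f ?E' ?V' (word_class E V w) = word_class ?E' ?V' (rename_letters f w)" if "w \<in> words V" for w
    by (rule induced_map_class[OF that cf])
  have hg: "?h g E V (word_class ?E' ?V' w) = word_class E V (rename_letters g w)" if "w \<in> words ?V'" for w
    by (rule induced_map_class[OF that cg])
  have "?h f ?E' ?V' \<in> hom (Raag E V) (Raag ?E' ?V')"
    by (rule induced_map_hom[OF cf]) (auto simp: rename_letters_def)
  moreover have "bij_betw (?h f ?E' ?V') (carrier (Raag E V)) (carrier (Raag ?E' ?V'))"
    by (rule bij_betw_byWitness[where f' = "?h g E V"])
      (auto simp: carrier_presented_group hf hg words words' rename_letters_ident g f')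
  ultimately show ?thesis by (intro exI isoI)
qed

definition max_degree_set :: "('a \<times> 'a) set \<Rightarrow> 'a set \<Rightarrow> 'a set" where
  "max_degree_set E V =
    {v \<in> V. \<forall>u\<in>V. card {w \<in> V. (u, w) \<in> E} \<le> card {w \<in> V. (v, w) \<in> E}}"

lemma word_class_Cons:
  assumes "x # w \<in> words V"
  shows "word_class E V (x # w) = word_class E V [x] \<otimes>\<^bsub>Raag E V\<^esub> word_class E V w"
  using assms mult_presented_group[of "[x]" V w] by simp

text \<open>
  By \<open>image_of_max_star_vanishes\<close>, following an automorphism by the retraction kills the vertices of
  maximal degree. The composite therefore factors through the retraction.
\<close>

lemma kill_max_degree_characteristic_epi:
  fixes E :: "('a \<times> 'a) set"
  assumes "Relation.sym E" "irrefl E" "finite V"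
  defines "C \<equiv> max_degree_set E V"
  shows "\<exists>f. characteristic_epi f (Raag E V) (Raag E (V - C))"
proof -
  let ?G = "Raag E V" and ?H = "Raag E (V - C)"
  interpret G: group ?G by (rule group_presented_group)
  interpret H: group ?H by (rule group_presented_group)
  define \<rho> where "\<rho> = induced_map (kill_letters C) (V - C) {commutator_word v w | v w. (v, w) \<in> E}"
  have \<rho>: "\<rho> (word_class E V w) = word_class E (V - C) (kill_letters C w)" if "w \<in> words V" for w
    unfolding \<rho>_def by (rule induced_map_class[OF that kill_letters_cong])
  have \<rho>_hom: "\<rho> \<in> hom ?G ?H"
    unfolding \<rho>_def by (rule induced_map_hom[OF kill_letters_cong]) (auto simp: kill_letters_def)
  interpret \<rho>: group_hom ?G ?H \<rho> by unfold_locales (rule \<rho>_hom)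
  have embed: "(u, v) \<in> raag_rel E V" if "(u, v) \<in> raag_rel E (V - C)" for u v
    using rename_letters_cong[OF that, of id V E] by (auto simp: rename_letters_def)
  have surj: "\<rho> ` carrier ?G = carrier ?H"
  proof
    show "carrier ?H \<subseteq> \<rho> ` carrier ?G"
    proof
      fix y assume "y \<in> carrier ?H"
      then obtain w where w: "w \<in> words (V - C)" "y = word_class E (V - C) w"
        by (auto simp: carrier_presented_group)
      then have "kill_letters C w = w" "w \<in> words V"
        by (auto simp: kill_letters_def words_def intro!: filter_True)
      then have "y = \<rho> (word_class E V w)" using \<rho> w by simp
      then show "y \<in> \<rho> ` carrier ?G" using \<open>w \<in> words V\<close> by auto
    qed
  qed auto
  have "\<rho> (\<phi> x) = \<one>\<^bsub>?H\<^esub>" if \<phi>: "\<phi> \<in> iso ?G ?G" and x: "x \<in> carrier ?G" "\<rho> x = \<one>\<^bsub>?H\<^esub>" for \<phi> x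
  proof -
    obtain \<psi> where \<psi>: "\<psi> \<in> iso ?G ?G" "\<forall>x\<in>carrier ?G. \<phi> (\<psi> x) = x"
        "\<forall>x\<in>carrier ?G. \<psi> (\<phi> x) = x"
      by (rule iso_inverse[OF G.is_group \<phi>])
    have ex: "\<exists>p. \<forall>v\<in>V. p v \<in> words V \<and> \<theta> (generator E V v) = word_class E V (p v)"
      if "\<theta> \<in> iso ?G ?G" for \<theta>
    proof (rule bchoice, rule ballI)
      fix v assume "v \<in> V"
      then have "\<theta> (generator E V v) \<in> carrier ?G" using iso_closed[OF that] by simp
      then show "\<exists>w. w \<in> words V \<and> \<theta> (generator E V v) = word_class E V w"
        by (auto simp: carrier_presented_group)
    qed
    obtain p where p: "\<And>v. v \<in> V \<Longrightarrow> p v \<in> words V" "\<And>v. v \<in> V \<Longrightarrow> \<phi> (generator E V v) = word_class E V (p v)"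
      using ex[OF \<phi>] by blast
    obtain q where q: "\<And>v. v \<in> V \<Longrightarrow> q v \<in> words V" "\<And>v. v \<in> V \<Longrightarrow> \<psi> (generator E V v) = word_class E V (q v)"
      using ex[OF \<psi>(1)] by blast
    have comm: "(p u @ p v, p v @ p u) \<in> raag_rel E V"
      if "\<theta> \<in> iso ?G ?G" "\<And>v. v \<in> V \<Longrightarrow> p v \<in> words V"
        "\<And>v. v \<in> V \<Longrightarrow> \<theta> (generator E V v) = word_class E V (p v)"
        "u \<in> V" "v \<in> V" "(u, v) \<in> E" for \<theta> p u v
    proof -
      have "\<theta> (generator E V u) \<otimes>\<^bsub>?G\<^esub> \<theta> (generator E V v) = \<theta> (generator E V v) \<otimes>\<^bsub>?G\<^esub> \<theta> (generator E V u)"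
        using generators_commute[OF that(6,4,5)] that(4,5)
          iso_mult[OF that(1), of "generator E V u" "generator E V v"]
          iso_mult[OF that(1), of "generator E V v" "generator E V u"] by simp
      then show ?thesis
        using that by (simp add: mult_presented_group pres_class_eq_iff)
    qed
    \<comment> \<open>The exponent sums define the coordinates of the abelianization.\<close>
    define \<epsilon> where "\<epsilon> u A = exponent_sum u (SOME w. w \<in> A)" for u and A :: "'a word set"
    have \<epsilon>: "\<epsilon> u (word_class E V w) = exponent_sum u w" if "w \<in> words V" for u w
      unfolding \<epsilon>_def by (rule exponent_sum_cong[OF pres_rel_some[OF that], symmetric])
    have \<epsilon>_mult: "\<epsilon> u (a \<otimes>\<^bsub>?G\<^esub> b) = \<epsilon> u a + \<epsilon> u b" if "a \<in> carrier ?G" "b \<in> carrier ?G" for u a b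
      using that by (auto simp: carrier_presented_group mult_presented_group \<epsilon>)
    have \<epsilon>_one: "\<epsilon> u \<one>\<^bsub>?G\<^esub> = 0" for u by (simp add: one_presented_group \<epsilon>)
    have \<epsilon>_image: "\<epsilon> u (\<theta> (word_class E V w)) = (\<Sum>t\<in>V. exponent_sum t w * exponent_sum u (p t))"
      if \<theta>: "\<theta> \<in> iso ?G ?G" and p: "\<And>v. v \<in> V \<Longrightarrow> p v \<in> words V"
        "\<And>v. v \<in> V \<Longrightarrow> \<theta> (generator E V v) = word_class E V (p v)"
        and "w \<in> words V" for \<theta> p u w
      using that(4)
    proof (induction w)
      case Nil
      have "\<theta> \<one>\<^bsub>?G\<^esub> = \<one>\<^bsub>?G\<^esub>" by (rule iso_one[OF G.is_group \<theta>])
      then show ?case using \<epsilon>_one by (simp add: one_presented_group)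
    next
      case (Cons x w)
      obtain s b where x: "x = (s, b)" "s \<in> V" using Cons.prems by (cases x) auto
      have c: "generator E V s \<in> carrier ?G" "word_class E V [x] \<in> carrier ?G" "word_class E V w \<in> carrier ?G"
        using x Cons.prems by auto
      have "\<epsilon> u (\<theta> (word_class E V [x])) = (if b then 1 else -1) * exponent_sum u (p s)"
      proof (cases b)
        case True
        then show ?thesis using x p \<epsilon> by simp
      next
        case False
        have "word_class E V [x] \<otimes>\<^bsub>?G\<^esub> generator E V s = \<one>\<^bsub>?G\<^esub>"
          using False x inv_generator[OF x(2), of E] G.l_inv[OF c(1)] by simp
        then have "\<theta> (word_class E V [x]) \<otimes>\<^bsub>?G\<^esub> \<theta> (generator E V s) = \<one>\<^bsub>?G\<^esub>"
          using iso_mult[OF \<theta> c(2,1)] iso_one[OF G.is_group \<theta>] by simp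
        then have "\<epsilon> u (\<theta> (word_class E V [x])) + \<epsilon> u (\<theta> (generator E V s)) = 0"
          using \<epsilon>_mult[OF iso_closed[OF \<theta> c(2)] iso_closed[OF \<theta> c(1)], of u] \<epsilon>_one[of u] by simp
        then show ?thesis using False x p \<epsilon> by simp
      qed
      moreover have "\<epsilon> u (\<theta> (word_class E V (x # w))) =
          \<epsilon> u (\<theta> (word_class E V [x])) + \<epsilon> u (\<theta> (word_class E V w))"
        unfolding word_class_Cons[OF Cons.prems] iso_mult[OF \<theta> c(2,3)]
        by (rule \<epsilon>_mult[OF iso_closed[OF \<theta> c(2)] iso_closed[OF \<theta> c(3)]])
      moreover have "(\<Sum>t\<in>V. exponent_sum t (x # w) * exponent_sum u (p t)) =
          (\<Sum>t\<in>V. if t = s then (if b then 1 else -1) * exponent_sum u (p t) else 0) +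
          (\<Sum>t\<in>V. exponent_sum t w * exponent_sum u (p t))"
        unfolding sum.distrib [symmetric] by (rule sum.cong) (auto simp: x distrib_right)
      ultimately show ?case using Cons x assms(3) by simp
    qed
    have inverse: "(\<Sum>t\<in>V. exponent_sum t (q w) * exponent_sum u (p t)) = (if u = w then 1 else 0)"
      if "\<theta> \<in> iso ?G ?G" "\<And>v. v \<in> V \<Longrightarrow> p v \<in> words V"
        "\<And>v. v \<in> V \<Longrightarrow> \<theta> (generator E V v) = word_class E V (p v)"
        "\<And>v. v \<in> V \<Longrightarrow> q v \<in> words V"
        "\<And>v. v \<in> V \<Longrightarrow> \<theta>' (generator E V v) = word_class E V (q v)"
        "\<forall>x\<in>carrier ?G. \<theta> (\<theta>' x) = x" "w \<in> V" for \<theta> \<theta>' p q u w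
    proof -
      have "\<epsilon> u (\<theta> (word_class E V (q w))) = \<epsilon> u (generator E V w)"
        using that(5)[OF that(7)] bspec[OF that(6), of "generator E V w"] that(7) by simp
      then show ?thesis
        using \<epsilon>_image[OF that(1-3) that(4)[OF that(7)], of u] \<epsilon>[of "[(w, True)]"] that(7) by auto
    qed
    interpret S: inverse_substitutions E V p q
    proof
      fix u v assume uv: "u \<in> V" "v \<in> V"
      show "(u, v) \<in> E \<Longrightarrow> (p u @ p v, p v @ p u) \<in> raag_rel E V" by (rule comm[OF \<phi> p uv])
      show "(u, v) \<in> E \<Longrightarrow> (q u @ q v, q v @ q u) \<in> raag_rel E V" by (rule comm[OF \<psi>(1) q uv])
      show "(\<Sum>t\<in>V. exponent_sum t (q v) * exponent_sum u (p t)) = (if u = v then 1 else 0)"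
        by (rule inverse[OF \<phi> p q \<psi>(2) uv(2)])
      show "(\<Sum>t\<in>V. exponent_sum t (p v) * exponent_sum u (q t)) = (if u = v then 1 else 0)"
        by (rule inverse[OF \<psi>(1) q p \<psi>(3) uv(2)])
    qed (use assms p q in auto)
    have "card (S.star v) = Suc (card {w \<in> V. (v, w) \<in> E})" if "v \<in> V" for v
    proof -
      have "S.star v = insert v {w \<in> V. (v, w) \<in> E}" using that by (auto simp: S.star_def)
      moreover have "v \<notin> {w \<in> V. (v, w) \<in> E}" using assms(2) by (auto simp: irrefl_def)
      ultimately show ?thesis using assms(3) by simp
    qed
    then have C: "S.max_star = C" by (auto simp: S.max_star_def C_def max_degree_set_def)
    have letter: "\<rho> (\<phi> (word_class E V [(v, b)])) = \<one>\<^bsub>?H\<^esub>" if "v \<in> C" for v b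
    proof -
      have v: "v \<in> V" using that by (simp add: C_def max_degree_set_def)
      have "(kill_letters C (p v), []) \<in> raag_rel E (V - C)"
        using S.image_of_max_star_vanishes[of v] that by (simp add: C kill_letters_def)
      then have T: "\<rho> (\<phi> (generator E V v)) = \<one>\<^bsub>?H\<^esub>"
        using p v kill_letters_words[OF p(1)[OF v], of C] by (simp add: \<rho> one_presented_group pres_class_eq_iff)
      interpret \<phi>: group_hom ?G ?G \<phi> by unfold_locales (use \<phi> in \<open>simp add: iso_def\<close>)
      have "\<rho> (\<phi> (word_class E V [(v, False)])) = \<one>\<^bsub>?H\<^esub>"
        unfolding inv_generator[OF v, symmetric] using v T by simp
      then show ?thesis using T by (cases b) auto
    qed
    have "\<rho> (\<phi> (word_class E V w)) = \<rho> (\<phi> (word_class E V (kill_letters C w)))" if "w \<in> words V" for w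
      using that
    proof (induction w)
      case (Cons x w)
      have kw: "kill_letters C w \<in> words V" using Cons.prems by (auto simp: kill_letters_def words_def)
      have mult: "\<rho> (\<phi> (word_class E V (x # u))) = \<rho> (\<phi> (word_class E V [x])) \<otimes>\<^bsub>?H\<^esub> \<rho> (\<phi> (word_class E V u))"
        if "u \<in> words V" for u
        using Cons.prems that iso_closed[OF \<phi>]
        by (subst word_class_Cons) (simp_all add: iso_mult[OF \<phi>])
      show ?case
      proof (cases "fst x \<in> C")
        case True
        then have "\<rho> (\<phi> (word_class E V [x])) = \<one>\<^bsub>?H\<^esub>" using letter[of "fst x" "snd x"] by simp
        moreover have "kill_letters C (x # w) = kill_letters C w"
          using True by (simp add: kill_letters_def)
        moreover have "\<rho> (\<phi> (word_class E V (kill_letters C w))) \<in> carrier ?H"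
          using kw iso_closed[OF \<phi>] by simp
        ultimately show ?thesis using mult[of w] Cons by simp
      next
        case False
        then have "kill_letters C (x # w) = x # kill_letters C w" by (simp add: kill_letters_def)
        then show ?thesis using mult[of w] mult[OF kw] Cons by simp
      qed
    qed (simp add: kill_letters_def)
    moreover obtain w where w: "w \<in> words V" "x = word_class E V w"
      using x(1) by (auto simp: carrier_presented_group)
    moreover have "(kill_letters C w, []) \<in> raag_rel E V"
      using x(2) w kill_letters_words[OF w(1), of C]
      by (intro embed) (simp add: \<rho> one_presented_group pres_class_eq_iff)
    then have "word_class E V (kill_letters C w) = \<one>\<^bsub>?G\<^esub>"
      unfolding one_presented_group by (rule equiv_class_eq[OF equiv_pres_rel])
    ultimately have "\<rho> (\<phi> x) = \<rho> (\<phi> \<one>\<^bsub>?G\<^esub>)" by simp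
    then show ?thesis using iso_one[OF G.is_group \<phi>] by simp
  qed
  then have "characteristic_epi \<rho> ?G ?H"
    using \<rho>_hom surj unfolding characteristic_epi_def by blast
  then show ?thesis by blast
qed

section \<open>Iterating the removal of vertices of maximal degree\<close>

definition induced_graph :: "('a \<times> 'a) set \<Rightarrow> 'a set \<Rightarrow> 'a pair_pre_digraph" where
  "induced_graph E V = \<lparr>pverts = V, parcs = E \<inter> (V \<times> V)\<rparr>"

lemma induced_graph_simps [simp]:
  "pverts (induced_graph E V) = V" "parcs (induced_graph E V) = E \<inter> (V \<times> V)"
  by (simp_all add: induced_graph_def)

lemma finite_simple_graph_induced_graph:
  assumes "Relation.sym E" "irrefl E" "finite V" "V \<noteq> {}"
  shows "finite_simple_graph (induced_graph E V)"
proof -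
  have "Relation.sym (E \<inter> (V \<times> V))" using assms(1) by (auto simp: sym_def)
  then have "pair_graph (induced_graph E V)"
    using assms(2,3) by unfold_locales (auto simp: symmetric_def irrefl_def)
  then show ?thesis using assms(4) by (simp add: finite_simple_graph_def)
qed

lemma raag_induced_graph: "raag (with_proj (induced_graph E V)) = Raag E V"
  unfolding raag_def by (simp only: with_proj_simps induced_graph_simps) (rule Raag_cong, auto)

lemma out_degree_induced_graph:
  assumes "v \<in> V"
  shows "out_degree (with_proj (induced_graph E V)) v = card {w \<in> V. (v, w) \<in> E}"
proof -
  have "out_arcs (with_proj (induced_graph E V)) v = Pair v ` {w \<in> V. (v, w) \<in> E}"
    using assms by (auto simp: out_arcs_def)
  then show ?thesis by (simp add: out_degree_def card_image inj_on_def)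
qed

lemma max_degree_verts_induced_graph:
  "max_degree_verts (with_proj (induced_graph E V)) = max_degree_set E V"
  by (auto simp: max_degree_verts_def max_degree_set_def out_degree_induced_graph)

lemma complete_induced_graph:
  "complete_graph (with_proj (induced_graph E V)) \<longleftrightarrow> (\<forall>u\<in>V. \<forall>v\<in>V. u \<noteq> v \<longrightarrow> (u, v) \<in> E)"
  by (auto simp: complete_graph_def)

lemma complete_induced_subgraph:
  assumes "W \<subseteq> V"
  shows "complete_graph (with_proj (induced_graph E V) \<restriction> W) \<longleftrightarrow> complete_graph (with_proj (induced_graph E W))"
proof -
  have "arcs_ends (with_proj (induced_graph E V) \<restriction> W) = E \<inter> (W \<times> W)"
    using assms by (auto simp: arcs_ends_def arc_to_ends_def image_iff)
  then show ?thesis by (auto simp: complete_graph_def)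
qed

text \<open>The three kinds of graphs at which the iteration stops.\<close>

definition terminal_graph :: "'a pair_pre_digraph \<Rightarrow> bool" where
  "terminal_graph G \<longleftrightarrow>
    \<not> connected_graph (with_proj G) \<or>
    connected_graph (with_proj G) \<and> regular_graph (with_proj G) \<and> \<not> complete_graph (with_proj G) \<or>
    \<not> regular_graph (with_proj G) \<and> connected_graph (with_proj G) \<and>
      complete_graph (with_proj G \<restriction> (pverts G - max_degree_verts (with_proj G)))"

text \<open>
  As long as the graph is not of one of the three kinds, the vertices that are not of maximal degree
  induce a non-complete graph, and the vertices of maximal degree can be killed.
\<close>

lemma terminal_characteristic_epi:
  assumes "Relation.sym E" "irrefl E"
    and "finite V" "\<not> complete_graph (with_proj (induced_graph E V))"
  shows "\<exists>W f. finite W \<and> W \<noteq> {} \<and> terminal_graph (induced_graph E W) \<and>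
    characteristic_epi f (Raag E V) (Raag E W)"
  using assms(3,4)
proof (induction "card V" arbitrary: V rule: less_induct)
  case less
  have ne: "V \<noteq> {}" using less.prems(2) by (auto simp: complete_induced_graph)
  show ?case
  proof (cases "terminal_graph (induced_graph E V)")
    case True
    moreover have "characteristic_epi id (Raag E V) (Raag E V)"
      by (rule iso_imp_characteristic_epi[OF group_presented_group group_presented_group id_iso])
    ultimately show ?thesis using less.prems(1) ne by blast
  next
    case False
    let ?C = "max_degree_set E V"
    have noncomplete: "\<not> complete_graph (with_proj (induced_graph E (V - ?C)))"
      using False less.prems(2)
      by (auto simp: terminal_graph_def max_degree_verts_induced_graph complete_induced_subgraph)
    define d where "d v = card {w \<in> V. (v, w) \<in> E}" for v
    have "Max (d ` V) \<in> d ` V" using ne less.prems(1) by simp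
    then obtain v where "v \<in> V" "d v = Max (d ` V)" by auto
    moreover have "d u \<le> Max (d ` V)" if "u \<in> V" for u using that less.prems(1) by simp
    ultimately have "v \<in> ?C \<inter> V" by (simp add: max_degree_set_def d_def)
    then have "card (V - ?C) < card V"
      using less.prems(1) by (intro psubset_card_mono) auto
    then obtain W f where W: "finite W" "W \<noteq> {}" "terminal_graph (induced_graph E W)"
        "characteristic_epi f (Raag E (V - ?C)) (Raag E W)"
      using less.hyps[of "V - ?C"] less.prems(1) noncomplete by auto
    obtain g where "characteristic_epi g (Raag E V) (Raag E (V - ?C))"
      using kill_max_degree_characteristic_epi[OF assms(1,2) less.prems(1)] by blast
    then have "characteristic_epi (f \<circ> g) (Raag E V) (Raag E W)"
      by (rule characteristic_epi_comp[OF group_presented_group group_presented_group _ W(4)])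
    then show ?thesis using W(1-3) by blast
  qed
qed

theorem lemma3p2p5:
  fixes \<Gamma> :: "'a pair_pre_digraph"
  assumes "finite_simple_graph \<Gamma>"
    and "\<not> complete_graph (with_proj \<Gamma>)"
  shows "\<exists>\<Gamma>' :: nat pair_pre_digraph.
    finite_simple_graph \<Gamma>' \<and>
    characteristic_quotient (raag (with_proj \<Gamma>')) (raag (with_proj \<Gamma>)) \<and>
    (\<not> connected_graph (with_proj \<Gamma>') \<or>
     connected_graph (with_proj \<Gamma>') \<and> regular_graph (with_proj \<Gamma>') \<and>
       \<not> complete_graph (with_proj \<Gamma>') \<or>
     \<not> regular_graph (with_proj \<Gamma>') \<and> connected_graph (with_proj \<Gamma>') \<and>
       complete_graph (with_proj \<Gamma>' \<restriction> (pverts \<Gamma>' - max_degree_verts (with_proj \<Gamma>'))))"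
proof -
  interpret pair_graph \<Gamma> using assms(1) by (simp add: finite_simple_graph_def)
  obtain f :: "'a \<Rightarrow> nat" where f: "inj_on f (pverts \<Gamma>)"
    using finite_imp_inj_to_nat_seg[OF pair_finite_verts] by blast
  \<comment> \<open>The vertices are renamed to natural numbers before any of them is removed.\<close>
  let ?E = "map_prod f f ` parcs \<Gamma>" and ?V = "f ` pverts \<Gamma>"
  have arcs: "parcs \<Gamma> \<subseteq> pverts \<Gamma> \<times> pverts \<Gamma>" using wellformed' by auto
  have E_iff: "(f u, f v) \<in> ?E \<longleftrightarrow> (u, v) \<in> parcs \<Gamma>" if "u \<in> pverts \<Gamma>" "v \<in> pverts \<Gamma>" for u v
  proof
    assume "(f u, f v) \<in> ?E"
    then obtain a b where ab: "(a, b) \<in> parcs \<Gamma>" "f u = f a" "f v = f b" by auto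
    then have "u = a" "v = b" using arcs that inj_onD[OF f] by blast+
    then show "(u, v) \<in> parcs \<Gamma>" using ab(1) by simp
  qed force
  have "Relation.sym ?E" using arcs_symmetric by (auto intro!: symI)
  moreover have "irrefl ?E"
  proof (rule irreflI)
    fix x
    show "(x, x) \<notin> ?E"
    proof
      assume "(x, x) \<in> ?E"
      then obtain a b where "(a, b) \<in> parcs \<Gamma>" "x = f a" "x = f b" by auto
      then have "(a, a) \<in> parcs \<Gamma>" using arcs inj_onD[OF f, of a b] by auto
      then show False using pair_no_loops by fastforce
    qed
  qed
  moreover have "finite ?V" using pair_finite_verts by simp
  moreover have "\<not> complete_graph (with_proj (induced_graph ?E ?V))"
  proof -
    obtain u v where "u \<in> pverts \<Gamma>" "v \<in> pverts \<Gamma>" "u \<noteq> v" "(u, v) \<notin> parcs \<Gamma>"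
      using assms(2) by (auto simp: complete_graph_def)
    then show ?thesis
      using E_iff f unfolding complete_induced_graph by (metis imageI inj_onD)
  qed
  ultimately obtain W h where W: "finite W" "W \<noteq> {}" "terminal_graph (induced_graph ?E W)"
      "characteristic_epi h (Raag ?E ?V) (Raag ?E W)" and E: "Relation.sym ?E" "irrefl ?E"
    using terminal_characteristic_epi[of ?E ?V] by blast
  obtain g where "g \<in> iso (Raag (parcs \<Gamma>) (pverts \<Gamma>)) (Raag ?E ?V)"
    using Raag_relabel[OF f arcs] by blast
  then have "characteristic_epi g (Raag (parcs \<Gamma>) (pverts \<Gamma>)) (Raag ?E ?V)"
    by (rule iso_imp_characteristic_epi[OF group_presented_group group_presented_group])
  from characteristic_epi_comp[OF group_presented_group group_presented_group this W(4)]
  have "characteristic_quotient (Raag ?E W) (Raag (parcs \<Gamma>) (pverts \<Gamma>))"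
    by (rule characteristic_epi_imp_quotient[OF group_presented_group group_presented_group])
  then have "characteristic_quotient (raag (with_proj (induced_graph ?E W))) (raag (with_proj \<Gamma>))"
    unfolding raag_induced_graph by (simp add: raag_def)
  then show ?thesis
    using finite_simple_graph_induced_graph[OF E W(1,2)] W(3)
    unfolding terminal_graph_def by blast
qed

end
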